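(* For every random variable $F:\Omega\to[0,1]$, $$I(E[F])\le E\left[\sqrt{I(F)^2+2\int_X |D_xF|^2\,\sigma(dx)}\,\right],$$ where $I(t)=\varphi(\Phi^{-1}(t))$, $0\le t\le 1$, is the Gaussian isoperimetric function.
   Context: $X$ is a metric space with Borel $\sigma$-algebra $\mathcal B(X)$ and $\sigma$ is a finite diffuse (atomless) measure on $X$. $\Omega$ is the set of Radon measures $\omega=\sum_{i=1}^N\delta_{x_i}$ with pairwise distinct $x_i\in X$, $N\in\mathbb N\cup\{\infty\}$; $\omega$ is identified with the set $\{x_1,x_2,\dots\}$. $\mathcal F$ is the $\sigma$-algebra generated by the maps $\omega\mapsto\omega(B)$, $B\in\mathcal B(X)$, and $\pi$ is the Poisson measure on $(\Omega,\mathcal F)$ with intensity $\sigma$ (for disjoint $A_1,\dots,A_n$ the $\omega(A_i)$ are independent Poisson variables with means $\sigma(A_i)$); $E$ is expectation under $\pi$. Random variables are $\mathcal F$-measurable. Finite difference gradient: $D_xF(\omega)=(F(\omega)-F(\omega+\delta_x))1_{\{x\notin\omega\}}+(F(\omega)-F(\omega-\delta_x))1_{\{x\in\omega\}}$. $\varphi$ and $\Phi$ are the standard Gaussian density and distribution function; $I(0)=I(1)=0$. *)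

theory Defs
  imports "HOL-Probability.Probability"
begin

(* A configuration is represented by the set of its points; point_measure_of w is the
   associated Borel measure, the sum of the Dirac masses at the points of w. *)
definition point_measure_of :: "'a::metric_space set \<Rightarrow> 'a measure" where
  "point_measure_of \<omega> = distr (count_space \<omega>) borel (\<lambda>x. x)"

lemma emeasure_point_measure_of:
  assumes "B \<in> sets borel"
  shows "emeasure (point_measure_of \<omega>) B = emeasure (count_space UNIV) (\<omega> \<inter> B)"
proof -
  have "emeasure (point_measure_of \<omega>) B = emeasure (count_space \<omega>) (B \<inter> \<omega>)"
    unfolding point_measure_of_def using assms by (subst emeasure_distr) auto
  then show ?thesis
    by (auto simp: emeasure_count_space Int_commute)
qed

definition radon_measure :: "'a::metric_space measure \<Rightarrow> bool" where
  "radon_measure M \<longleftrightarrow>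
     sets M = sets borel \<and>
     (\<forall>x. \<exists>U. open U \<and> x \<in> U \<and> emeasure M U < \<infinity>) \<and>
     (\<forall>B \<in> sets borel. emeasure M B = (SUP K \<in> {K. compact K \<and> K \<subseteq> B}. emeasure M K))"

definition configurations :: "'a::metric_space set set" where
  "configurations = {\<omega>. countable \<omega> \<and> radon_measure (point_measure_of \<omega>)}"

definition configuration_space :: "'a::metric_space set measure" where
  "configuration_space = sigma configurations
     {(\<lambda>\<omega>. emeasure (point_measure_of \<omega>) B) -` S \<inter> configurations | B S.
        B \<in> sets borel \<and> S \<in> sets (borel :: ennreal measure)}"

(* The explicit Poisson weights cover the degenerate case measure \<sigma> B = 0 (as 0 ^ 0 = 1),
   which poisson_pmf excludes. *)
definition poisson_measure :: "'a::metric_space measure \<Rightarrow> 'a set measure \<Rightarrow> bool" where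
  "poisson_measure \<sigma> \<pi> \<longleftrightarrow>
     prob_space \<pi> \<and>
     sets \<pi> = sets configuration_space \<and>
     (\<forall>B \<in> sets borel. \<forall>k::nat.
        measure \<pi> {\<omega> \<in> space \<pi>. emeasure (point_measure_of \<omega>) B = of_nat k} =
          exp (- measure \<sigma> B) * measure \<sigma> B ^ k / fact k) \<and>
     (\<forall>(n::nat) A. (\<forall>i<n. A i \<in> sets borel) \<and> disjoint_family_on A {..<n} \<longrightarrow>
        prob_space.indep_vars \<pi> (\<lambda>_. borel)
          (\<lambda>i \<omega>. emeasure (point_measure_of \<omega>) (A i)) {..<n})"

definition fd_gradient :: "'a \<Rightarrow> ('a set \<Rightarrow> real) \<Rightarrow> 'a set \<Rightarrow> real" where
  "fd_gradient x F \<omega> =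
     (F \<omega> - F (insert x \<omega>)) * indicator {x. x \<notin> \<omega>} x +
     (F \<omega> - F (\<omega> - {x})) * indicator {x. x \<in> \<omega>} x"

definition Gauss_cdf :: "real \<Rightarrow> real" where
  "Gauss_cdf = cdf std_normal_distribution"

(* Gauss_cdf is a bijection from the reals onto the open unit interval, so inv is its
   genuine inverse there. *)
definition Gauss_isoperimetric :: "real \<Rightarrow> real" where
  "Gauss_isoperimetric t =
     (if 0 < t \<and> t < 1 then std_normal_density (inv Gauss_cdf t) else 0)"

end

(* Let I be the Gaussian isoperimetric function. Birnbaum's bound for the Mills ratio gives
     I(a) >= I(b) + I'(b) (a - b) - (a - b)^2 / I(b),
   so one small step Q = 1 + h L of the Poisson growth process (L adds a point chosen from the
   intensity) satisfies I(Q G)^2 <= (Q I(G))^2 + 2 h |D Q G|^2 + O(h^2). As Q commutes with D,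
   Minkowski's inequality makes Q^k sqrt (I(Q^(n-k) F)^2 + 2 k h |D Q^(n-k) F|^2) increase in k up
   to O(h^2) per step. With h = 1/n and n -> infinity, Q^n tends to the expectation under the
   Poisson law started from the empty configuration.

   The space X need not be separable, so (omega, x) |-> omega u {x} may fail to be jointly
   measurable. A random variable depends on countably many counts omega(B_i) only, and the process
   is run on the sequences of these counts instead. *)
theory Submission
  imports Defs "HOL-Real_Asymp.Real_Asymp"
begin

section \<open>The Gaussian isoperimetric function\<close>

text \<open>The error of one step is an error between squares, and turning it into an error between
  square roots costs a division by the roots themselves. These are bounded below by some
  \<open>c > 0\<close> as long as the function stays in an interval \<open>[e, 1 - e]\<close>, which
  every step preserves; then n steps with h = 1/n cost \<open>C / (c n)\<close> in all. Replacing
  \<open>F\<close> by \<open>(1 - 2 e) F + e\<close> shrinks the gradient, so dominated convergence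
  lifts the restriction at the end.

  On sequences of counts a jump adds a vector that does not depend on the state. Jumps therefore
  commute, and products of powers of the counts are eigenfunctions of the jump operator, even when a
  point is hit twice. For a configuration \<open>\<omega>\<close> such a jump disagrees with the
  gradient only at points x of \<open>\<omega>\<close>, which form a countable set, null for the
  diffuse measure \<open>\<sigma>\<close>. As \<open>\<sigma>\<close> is finite, almost every
  configuration is finite and its counts are natural numbers.\<close>

lemma std_normal_density_pos: "0 < std_normal_density x"
  by (simp add: std_normal_density_def)

lemma std_normal_density_le_1: "std_normal_density x \<le> 1"
proof -
  have "1 \<le> sqrt (2 * pi)"
    using pi_gt3 by (intro real_le_rsqrt) auto
  moreover have "exp (- x\<^sup>2 / 2) \<le> 1"
    by simp
  ultimately show ?thesis
    unfolding std_normal_density_def by (intro mult_le_one) auto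
qed

lemma DERIV_std_normal_density:
  "(std_normal_density has_real_derivative - x * std_normal_density x) (at x)"
  unfolding std_normal_density_def[abs_def]
  by (auto intro!: derivative_eq_intros simp: field_simps)

lemma std_normal_density_minus [simp]: "std_normal_density (- x) = std_normal_density x"
  by (simp add: std_normal_density_def)

lemma continuous_on_std_normal_density [continuous_intros]: "continuous_on A std_normal_density"
  unfolding std_normal_density_def[abs_def] by (intro continuous_intros) auto

interpretation std_normal: real_distribution std_normal_distribution
  by (simp add: real_distribution_def real_distribution_axioms_def prob_space_normal_density)

lemma Gauss_cdf_at_top: "(Gauss_cdf \<longlongrightarrow> 1) at_top"
  unfolding Gauss_cdf_def by (rule std_normal.cdf_lim_at_top_prob)

lemma Gauss_cdf_at_bot: "(Gauss_cdf \<longlongrightarrow> 0) at_bot"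
  unfolding Gauss_cdf_def by (rule std_normal.cdf_lim_at_bot)

lemma Gauss_cdf_diff:
  assumes "a \<le> b"
  shows "Gauss_cdf b - Gauss_cdf a = integral {a..b} std_normal_density"
proof (cases "a = b")
  case False
  with assms have ab: "a < b" by simp
  have int: "set_integrable lborel {a..b} std_normal_density"
    by (rule borel_integrable_atLeastAtMost')
      (rule continuous_on_std_normal_density)
  have "ennreal (Gauss_cdf b - Gauss_cdf a) = emeasure std_normal_distribution {a<..b}"
    unfolding Gauss_cdf_def std_normal.cdf_diff_eq[OF ab] std_normal.emeasure_eq_measure ..
  also have "\<dots> = (\<integral>\<^sup>+x. ennreal (std_normal_density x) * indicator {a<..b} x \<partial>lborel)"
    by (subst emeasure_density) auto
  also have "\<dots> = (\<integral>\<^sup>+x. ennreal (indicator {a..b} x *\<^sub>R std_normal_density x) \<partial>lborel)"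
    by (intro nn_integral_cong_AE, rule eventually_mono[OF AE_lborel_singleton[of a]])
      (auto simp: indicator_def)
  also have "\<dots> = ennreal (\<integral>x. indicator {a..b} x *\<^sub>R std_normal_density x \<partial>lborel)"
    using int unfolding set_integrable_def
    by (intro nn_integral_eq_integral) auto
  also have "(\<integral>x. indicator {a..b} x *\<^sub>R std_normal_density x \<partial>lborel)
      = integral {a..b} std_normal_density"
    using set_borel_integral_eq_integral(2)[OF int] unfolding set_lebesgue_integral_def .
  finally show ?thesis
    using ab by (subst (asm) ennreal_inj)
      (auto simp: Gauss_cdf_def std_normal.cdf_nondecreasing
        intro!: integral_nonneg integrable_continuous_real continuous_on_std_normal_density)
qed simp

lemma DERIV_Gauss_cdf: "(Gauss_cdf has_real_derivative std_normal_density x) (at x)"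
proof -
  have "((\<lambda>y. Gauss_cdf (x - 1) + integral {x - 1..y} std_normal_density)
      has_real_derivative 0 + std_normal_density x) (at x within {x - 1..x + 1})"
    by (intro derivative_intros integral_has_real_derivative continuous_on_std_normal_density) auto
  then have "((\<lambda>y. Gauss_cdf (x - 1) + integral {x - 1..y} std_normal_density)
      has_real_derivative std_normal_density x) (at x within {x - 1..x + 1})"
    by simp
  then have "(Gauss_cdf has_real_derivative std_normal_density x) (at x within {x - 1..x + 1})"
    by (rule has_field_derivative_transform_within[where d = 1])
      (auto simp: Gauss_cdf_diff[symmetric])
  then show ?thesis
    by (subst (asm) at_within_interior) auto
qed

lemmas DERIV_Gauss_cdf' [derivative_intros] = DERIV_Gauss_cdf[THEN DERIV_chain2]
lemmas DERIV_std_normal_density' [derivative_intros] = DERIV_std_normal_density[THEN DERIV_chain2]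

lemma strict_mono_Gauss_cdf: "strict_mono Gauss_cdf"
  by (rule strict_monoI, rule DERIV_pos_imp_increasing)
    (auto intro!: exI DERIV_Gauss_cdf std_normal_density_pos)

lemma Gauss_cdf_bounds: "0 < Gauss_cdf x" "Gauss_cdf x < 1"
proof -
  show "0 < Gauss_cdf x"
    by (rule DERIV_pos_imp_increasing_at_bot[OF _ Gauss_cdf_at_bot])
      (auto intro!: exI DERIV_Gauss_cdf std_normal_density_pos)
  have "((\<lambda>x. - Gauss_cdf x) \<longlongrightarrow> - 1) at_top"
    by (intro tendsto_intros Gauss_cdf_at_top)
  then have "- 1 < - Gauss_cdf x"
    by (rule DERIV_neg_imp_decreasing_at_top[rotated])
      (use std_normal_density_pos in \<open>auto intro!: exI derivative_eq_intros\<close>)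
  then show "Gauss_cdf x < 1" by simp
qed

lemma continuous_on_Gauss_cdf: "continuous_on A Gauss_cdf"
  by (rule DERIV_continuous_on, rule has_field_derivative_at_within, rule DERIV_Gauss_cdf)

lemma Gauss_cdf_surj:
  assumes "0 < t" "t < 1"
  obtains x where "Gauss_cdf x = t"
proof -
  have "eventually (\<lambda>x. Gauss_cdf x < t \<and> x < 0) at_bot"
    using order_tendstoD(2)[OF Gauss_cdf_at_bot assms(1)] eventually_gt_at_bot[of 0] 
    by (auto intro: eventually_conj eventually_at_bot_dense)
  then obtain a where a: "Gauss_cdf a < t" "a < 0"
    using eventually_happens trivial_limit_at_bot_linorder by blast
  have "eventually (\<lambda>x. Gauss_cdf x > t \<and> x > 0) at_top"
    using order_tendstoD(1)[OF Gauss_cdf_at_top assms(2)] eventually_gt_at_top[of 0]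
    by (auto intro: eventually_conj)
  then obtain b where b: "Gauss_cdf b > t" "b > 0"
    using eventually_happens trivial_limit_at_top_linorder by blast
  have "\<exists>x. a \<le> x \<and> x \<le> b \<and> Gauss_cdf x = t"
    using a b by (intro IVT' continuous_on_Gauss_cdf) auto
  then show ?thesis using that by blast
qed

lemma inv_Gauss_cdf [simp]: "inv Gauss_cdf (Gauss_cdf x) = x"
  using strict_mono_Gauss_cdf strict_mono_imp_inj_on inv_f_f by metis

lemma Gauss_isoperimetric_cdf: "Gauss_isoperimetric (Gauss_cdf x) = std_normal_density x"
  by (simp add: Gauss_isoperimetric_def Gauss_cdf_bounds)

section \<open>Birnbaum's inequality and quadratic bounds along the distribution function\<close>

lemma Gauss_cdf_minus: "Gauss_cdf (- x) = 1 - Gauss_cdf x"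
proof -
  define k where "k y = Gauss_cdf y + Gauss_cdf (- y)" for y
  have "(k has_real_derivative 0) (at y)" for y
    unfolding k_def[abs_def] by (auto intro!: derivative_eq_intros)
  then have const: "k y = k x" for y
    by (intro DERIV_isconst_all allI)
  have "(k \<longlongrightarrow> 1 + 0) at_top"
    unfolding k_def[abs_def]
    by (intro tendsto_add Gauss_cdf_at_top filterlim_compose[OF Gauss_cdf_at_bot]
        filterlim_uminus_at_bot_at_top)
  moreover have "(k \<longlongrightarrow> k x) at_top"
    by (subst const[abs_def]) simp
  ultimately have "k x = 1"
    using tendsto_unique[OF _ _ \<open>(k \<longlongrightarrow> k x) at_top\<close>] by force
  then show ?thesis by (simp add: k_def)
qed

text \<open>Read as a bound for the upper tail at \<open>- x\<close>, this is Birnbaum's inequality.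
  The factor \<open>r\<close> is the positive root of \<open>r^2 = x r + 1\<close>; this relation
  collects the terms of the derivative of \<open>k\<close> into \<open>r^2\<close> minus the
  derivative of \<open>r\<close>. That is positive, and \<open>k\<close> starts from 0 at minus
  infinity.\<close>

lemma Gauss_cdf_Birnbaum:
  "std_normal_density x * ((x + sqrt (x\<^sup>2 + 4)) / 2) \<le> Gauss_cdf x"
proof -
  define r where "r y = (y + sqrt (y\<^sup>2 + 4)) / 2" for y :: real
  define k where "k y = Gauss_cdf y - std_normal_density y * r y" for y
  have r2: "(r y)\<^sup>2 = y * r y + 1" for y
    unfolding r_def by (simp add: power2_eq_square field_simps)
  have r': "(r has_real_derivative r y / sqrt (y\<^sup>2 + 4)) (at y)" for y
  proof -
    have "0 < y\<^sup>2 + 4" by (simp add: add_nonneg_pos)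
    then show ?thesis unfolding r_def[abs_def]
      by (auto intro!: derivative_eq_intros simp: field_simps)
  qed
  have rp: "0 < r y" for y
  proof -
    have "\<bar>y\<bar> < sqrt (y\<^sup>2 + 4)"
      by (rule real_less_rsqrt) simp
    then show ?thesis unfolding r_def by auto
  qed
  have k': "(k has_real_derivative std_normal_density y * ((r y)\<^sup>2 - r y / sqrt (y\<^sup>2 + 4))) (at y)" for y
    unfolding k_def[abs_def] r2
    by (auto intro!: derivative_eq_intros r' simp: algebra_simps)
  \<comment> \<open>This amounts to \<open>1 < r y * sqrt (y^2 + 4)\<close>, which reduces to
    comparing squares: \<open>(y^2 + 2)^2 = y^2 (y^2 + 4) + 4\<close>.\<close>
  have pos: "(r y)\<^sup>2 - r y / sqrt (y\<^sup>2 + 4) > 0" for y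
  proof -
    have s: "0 < sqrt (y\<^sup>2 + 4)" by (simp add: add_nonneg_pos)
    have "(y\<^sup>2 + 2)\<^sup>2 > (\<bar>y\<bar> * sqrt (y\<^sup>2 + 4))\<^sup>2"
      by (simp add: power_mult_distrib power2_eq_square algebra_simps)
    then have "\<bar>y\<bar> * sqrt (y\<^sup>2 + 4) < y\<^sup>2 + 2"
      by (rule power2_less_imp_less) simp
    then have "- (y * sqrt (y\<^sup>2 + 4)) < y\<^sup>2 + 2"
      by (smt (verit) mult_minus_left s mult_right_mono)
    then have "1 < r y * sqrt (y\<^sup>2 + 4)"
      unfolding r_def by (simp add: field_simps power2_eq_square)
    then have "r y * 1 < r y * (r y * sqrt (y\<^sup>2 + 4))"
      using rp by (intro mult_strict_left_mono)
    then show ?thesis using s by (simp add: field_simps power2_eq_square)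
  qed
  have "((\<lambda>y. std_normal_density y * r y) \<longlongrightarrow> 0) at_bot"
    unfolding std_normal_density_def r_def by real_asymp
  then have "(k \<longlongrightarrow> 0 - 0) at_bot"
    unfolding k_def[abs_def] by (intro tendsto_intros Gauss_cdf_at_bot)
  then have "(k \<longlongrightarrow> 0) at_bot" by simp
  then have "0 < k x"
    by (rule DERIV_pos_imp_increasing_at_bot[rotated])
      (use k' pos std_normal_density_pos in \<open>auto intro!: exI\<close>)
  then show ?thesis by (simp add: k_def r_def)
qed

text \<open>Birnbaum's bound freed of its square root: as a quadratic in \<open>P\<close>, the
  expression \<open>P^2 - x p P - p^2\<close> has the positive root \<open>p r\<close>, and
  \<open>P\<close> lies to the right of it. In this form it settles the limit at infinity in the
  quadratic lower bound.\<close>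

lemma Gauss_cdf_quadratic:
  "(std_normal_density x)\<^sup>2 + x * Gauss_cdf x * std_normal_density x \<le> (Gauss_cdf x)\<^sup>2"
proof -
  define r where "r = (x + sqrt (x\<^sup>2 + 4)) / 2"
  define p where "p = std_normal_density x"
  define P where "P = Gauss_cdf x"
  have p: "0 < p" "p * r \<le> P"
    using Gauss_cdf_Birnbaum[of x] std_normal_density_pos by (auto simp: p_def P_def r_def)
  have r2: "r\<^sup>2 = x * r + 1"
    unfolding r_def by (simp add: power2_eq_square field_simps)
  have "\<bar>x\<bar> < sqrt (x\<^sup>2 + 4)"
    by (rule real_less_rsqrt) simp
  then have "x \<le> r" "0 < r" unfolding r_def by auto
  have "P\<^sup>2 - x * P * p - p\<^sup>2 = (P - p * r) * (P - p * r + p * (2 * r - x)) + p\<^sup>2 * (r\<^sup>2 - x * r - 1)"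
    by (simp add: algebra_simps power2_eq_square)
  also have "\<dots> \<ge> 0"
    using p r2 \<open>x \<le> r\<close> \<open>0 < r\<close> by (auto intro!: mult_nonneg_nonneg add_nonneg_nonneg)
  finally show ?thesis unfolding p_def P_def by simp
qed

text \<open>Concavity of the isoperimetric function, expressed at the points
  \<open>Gauss_cdf x\<close> and \<open>Gauss_cdf z\<close>, where its slope is \<open>- x\<close>.
  In this coordinate the derivative of the difference is the density times \<open>z - x\<close>, so
  \<open>x\<close> is the minimum and no inverse function has to be differentiated.\<close>

lemma Gauss_tangent_cdf:
  "std_normal_density z \<le> std_normal_density x - x * (Gauss_cdf z - Gauss_cdf x)"
proof -
  define K where "K z = std_normal_density x - x * (Gauss_cdf z - Gauss_cdf x) - std_normal_density z" for z
  have K': "(K has_real_derivative std_normal_density z * (z - x)) (at z)" for z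
    unfolding K_def[abs_def] by (auto intro!: derivative_eq_intros simp: algebra_simps)
  have "K x \<le> K z"
  proof (cases "x \<le> z")
    case True
    then show ?thesis
      by (rule DERIV_nonneg_imp_nondecreasing) (auto intro!: exI K' mult_nonneg_nonneg)
  next
    case False
    then have "z \<le> x" by simp
    then show ?thesis
      by (rule DERIV_nonpos_imp_nonincreasing) (auto intro!: exI K' mult_nonneg_nonpos)
  qed
  then show ?thesis by (simp add: K_def)
qed

text \<open>
  As a function of \<open>z\<close>, the difference \<open>H\<close> of the two sides has the derivative \<open>\<phi>(z) m(z)\<close>, where
  \<open>m\<close> first increases from \<open>m(x) = 0\<close> and then decreases. So \<open>H\<close> is smallest at \<open>x\<close>, where it
  vanishes, or at infinity, where Birnbaum's inequality applies.
\<close>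

lemma Gauss_quadratic_lower_cdf_right:
  assumes "x \<le> z"
  shows "std_normal_density x - x * (Gauss_cdf z - Gauss_cdf x)
      - (Gauss_cdf z - Gauss_cdf x)\<^sup>2 / std_normal_density x \<le> std_normal_density z"
proof -
  define p where "p = std_normal_density x"
  have p: "0 < p" by (simp add: p_def std_normal_density_pos)
  define H where "H z = std_normal_density z - p + x * (Gauss_cdf z - Gauss_cdf x)
    + (Gauss_cdf z - Gauss_cdf x)\<^sup>2 / p" for z
  define m where "m z = x - z + 2 * (Gauss_cdf z - Gauss_cdf x) / p" for z
  have H': "(H has_real_derivative std_normal_density z * m z) (at z)" for z
    unfolding H_def[abs_def] m_def using p
    by (auto intro!: derivative_eq_intros simp: field_simps)
  have m': "(m has_real_derivative 2 * std_normal_density z / p - 1) (at z)" for z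
    unfolding m_def[abs_def] using p by (auto intro!: derivative_eq_intros simp: field_simps)
  \<comment> \<open>To the right of \<open>x\<close>, the derivative of \<open>m\<close> changes
    sign at \<open>c\<close>: \<open>2 * std_normal_density z = p\<close> means
    \<open>z^2 = x^2 + 2 ln 2\<close>. Since \<open>\<bar>x\<bar> \<le> c\<close>, \<open>m\<close>
    increases on all of \<open>[x, c]\<close>, also when \<open>x\<close> is negative.\<close>
  define c where "c = sqrt (x\<^sup>2 + 2 * ln 2)"
  have xc: "\<bar>x\<bar> \<le> c" unfolding c_def by (rule real_le_rsqrt) simp
  have c2: "c\<^sup>2 = x\<^sup>2 + 2 * ln 2" unfolding c_def by simp
  have pc: "p = 2 * std_normal_density c"
  proof -
    have "- (x\<^sup>2 + 2 * ln 2) / 2 = - x\<^sup>2 / 2 - ln 2"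
      by (simp add: field_simps)
    then have "exp (- (x\<^sup>2 + 2 * ln 2) / 2) = exp (- x\<^sup>2 / 2) / 2"
      by (simp only: exp_diff) simp
    then show ?thesis
      unfolding p_def std_normal_density_def c2 by simp
  qed
  have dens: "std_normal_density a \<le> std_normal_density b" if "\<bar>b\<bar> \<le> \<bar>a\<bar>" for a b
    using that unfolding std_normal_density_def
    by (intro mult_left_mono) (auto simp: abs_le_square_iff)
  have up: "m a \<le> m b" if "x \<le> a" "a \<le> b" "b \<le> c" for a b
  proof (rule DERIV_nonneg_imp_nondecreasing[OF \<open>a \<le> b\<close>])
    fix y assume "a \<le> y" "y \<le> b"
    then have "std_normal_density c \<le> std_normal_density y"
      using that xc by (intro dens) auto
    then show "\<exists>d. (m has_real_derivative d) (at y) \<and> 0 \<le> d"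
      using p by (intro exI[of _ "2 * std_normal_density y / p - 1"] conjI m') (simp add: pc field_simps)
  qed
  have down: "m b \<le> m a" if "c \<le> a" "a \<le> b" for a b
  proof (rule DERIV_nonpos_imp_nonincreasing[OF \<open>a \<le> b\<close>])
    fix y assume "a \<le> y" "y \<le> b"
    then have "std_normal_density y \<le> std_normal_density c"
      using that xc by (intro dens) auto
    then show "\<exists>d. (m has_real_derivative d) (at y) \<and> d \<le> 0"
      using p by (intro exI[of _ "2 * std_normal_density y / p - 1"] conjI m') (simp add: pc field_simps)
  qed
  have mx: "m x = 0" by (simp add: m_def)
  have Hx: "H x = 0" by (simp add: H_def p_def)
  have "0 \<le> H z"
  proof (cases "m z \<ge> 0")
    case True
    have "0 \<le> m y" if "x \<le> y" "y \<le> z" for y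
      using up[of x y] down[of y z] that True mx xc by (cases "y \<le> c") auto
    then have "H x \<le> H z"
      by (intro DERIV_nonneg_imp_nondecreasing[OF assms])
        (auto intro!: exI H' mult_nonneg_nonneg)
    then show ?thesis by (simp add: Hx)
  next
    case False
    \<comment> \<open>Up to \<open>c\<close> the function \<open>m\<close> increases from 0, so a
      negative value can only occur in the decreasing range, and \<open>m\<close> stays negative
      from there on.\<close>
    then have "c \<le> z"
      using up[of x z] assms mx by linarith
    then have "m y \<le> 0" if "z \<le> y" for y
      using down[of z y] False that by linarith
    then have dec: "H y \<le> H z" if "z \<le> y" for y
      using that by (intro DERIV_nonpos_imp_nonincreasing[OF that])
        (auto intro!: exI H' mult_nonneg_nonpos)
    have "(std_normal_density \<longlongrightarrow> 0) at_top"
      unfolding std_normal_density_def[abs_def] by real_asymp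
    then have lim: "(H \<longlongrightarrow> 0 - p + x * (1 - Gauss_cdf x) + (1 - Gauss_cdf x)\<^sup>2 / p) at_top"
      unfolding H_def[abs_def] using p by (intro tendsto_intros Gauss_cdf_at_top) auto
    have "0 - p + x * (1 - Gauss_cdf x) + (1 - Gauss_cdf x)\<^sup>2 / p \<le> H z"
      using lim dec by (intro tendsto_upperbound[OF lim])
        (auto intro: eventually_at_top_linorderI)
    moreover have "p\<^sup>2 - x * (1 - Gauss_cdf x) * p \<le> (1 - Gauss_cdf x)\<^sup>2"
      using Gauss_cdf_quadratic[of "- x"] by (simp add: Gauss_cdf_minus p_def)
    then have "0 \<le> 0 - p + x * (1 - Gauss_cdf x) + (1 - Gauss_cdf x)\<^sup>2 / p"
      using p by (simp add: field_simps power2_eq_square)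
    ultimately show ?thesis by linarith
  qed
  then show ?thesis by (simp add: H_def p_def)
qed

text \<open>Reflection turns \<open>z < x\<close> into the previous case: the density is even, and
  differences of \<open>Gauss_cdf\<close> change their sign.\<close>

lemma Gauss_quadratic_lower_cdf:
  "std_normal_density x - x * (Gauss_cdf z - Gauss_cdf x)
      - (Gauss_cdf z - Gauss_cdf x)\<^sup>2 / std_normal_density x \<le> std_normal_density z"
proof (cases "x \<le> z")
  case False
  then show ?thesis
    using Gauss_quadratic_lower_cdf_right[of "- x" "- z"]
    by (simp add: Gauss_cdf_minus power2_eq_square algebra_simps)
qed (rule Gauss_quadratic_lower_cdf_right)

section \<open>The isoperimetric function in its own variable: tangents, lower bounds,
  continuity\<close>

lemma Gauss_isoperimetric_tangent:
  assumes "0 < a" "a < 1" "0 < b" "b < 1"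
  shows "Gauss_isoperimetric a \<le> Gauss_isoperimetric b - inv Gauss_cdf b * (a - b)"
proof -
  obtain z x where "Gauss_cdf z = a" "Gauss_cdf x = b"
    using assms Gauss_cdf_surj by metis
  then show ?thesis
    using Gauss_tangent_cdf[of z x] Gauss_isoperimetric_cdf[of z] Gauss_isoperimetric_cdf[of x] by auto
qed

text \<open>The slope at \<open>b\<close> is \<open>- inv Gauss_cdf b\<close>. As
  \<open>I'' = -1/I\<close>, the second-order Taylor coefficient would be 1/2 instead of 1; but
  adding one point can move \<open>F\<close> by any amount, so the bound must hold for distant
  \<open>a\<close> as well. The coefficient 1 becomes the factor 2 of the theorem when
  \<open>I\<close> is squared.\<close>

lemma Gauss_isoperimetric_quadratic_lower:
  assumes "0 < a" "a < 1" "0 < b" "b < 1"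
  shows "Gauss_isoperimetric b - inv Gauss_cdf b * (a - b) - (a - b)\<^sup>2 / Gauss_isoperimetric b
      \<le> Gauss_isoperimetric a"
proof -
  obtain z x where "Gauss_cdf z = a" "Gauss_cdf x = b"
    using assms Gauss_cdf_surj by metis
  then show ?thesis
    using Gauss_quadratic_lower_cdf[of x z] Gauss_isoperimetric_cdf[of z] Gauss_isoperimetric_cdf[of x] by auto
qed

lemma Gauss_isoperimetric_nonneg: "0 \<le> Gauss_isoperimetric t"
  by (simp add: Gauss_isoperimetric_def)

lemma Gauss_isoperimetric_le_1: "Gauss_isoperimetric t \<le> 1"
  by (simp add: Gauss_isoperimetric_def std_normal_density_le_1)

lemma inv_Gauss_cdf_mono:
  assumes "0 < a" "a \<le> b" "b < 1"
  shows "inv Gauss_cdf a \<le> inv Gauss_cdf b"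
proof -
  obtain z x where "Gauss_cdf z = a" "Gauss_cdf x = b"
    using assms Gauss_cdf_surj by (metis order.strict_trans1 order.strict_trans2)
  then show ?thesis
    using assms strict_mono_less_eq[OF strict_mono_Gauss_cdf, of z x] by auto
qed

text \<open>The quantiles of \<open>[e, 1 - e]\<close> form a bounded set, and the density decreases
  in the absolute value. The constant \<open>c\<close> is the divisor in all later error
  terms.\<close>

lemma Gauss_isoperimetric_lower_bound:
  assumes "0 < e" "e < 1"
  obtains c where "0 < c" "\<And>t. e \<le> t \<Longrightarrow> t \<le> 1 - e \<Longrightarrow> c \<le> Gauss_isoperimetric t"
proof -
  define y where "y = max \<bar>inv Gauss_cdf e\<bar> \<bar>inv Gauss_cdf (1 - e)\<bar>"
  show ?thesis
  proof
    show "0 < std_normal_density y" by (rule std_normal_density_pos)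
    fix t assume t: "e \<le> t" "t \<le> 1 - e"
    have "inv Gauss_cdf e \<le> inv Gauss_cdf t" "inv Gauss_cdf t \<le> inv Gauss_cdf (1 - e)"
      using assms t by (auto intro!: inv_Gauss_cdf_mono)
    then have "\<bar>inv Gauss_cdf t\<bar> \<le> \<bar>y\<bar>" unfolding y_def by linarith
    then have "std_normal_density y \<le> std_normal_density (inv Gauss_cdf t)"
      unfolding std_normal_density_def
      by (intro mult_left_mono) (auto simp: abs_le_square_iff)
    then show "std_normal_density y \<le> Gauss_isoperimetric t"
      using assms t by (simp add: Gauss_isoperimetric_def)
  qed
qed

lemma isCont_Gauss_isoperimetric_inner:
  assumes "0 < t" "t < 1"
  shows "isCont Gauss_isoperimetric t"
proof -
  obtain x where x: "Gauss_cdf x = t" using assms Gauss_cdf_surj by metis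
  have inv: "isCont (inv Gauss_cdf) t"
    unfolding x[symmetric]
    by (rule isCont_inverse_function[of 1])
      (auto intro: DERIV_isCont DERIV_Gauss_cdf)
  have "isCont (\<lambda>t. std_normal_density (inv Gauss_cdf t)) t"
    by (rule isCont_o2[OF inv]) (rule DERIV_isCont[OF DERIV_std_normal_density])
  moreover have "eventually (\<lambda>t. std_normal_density (inv Gauss_cdf t) = Gauss_isoperimetric t) (nhds t)"
    using eventually_nhds_in_open[of "{0<..<1}" t] assms
    by (auto elim!: eventually_mono simp: Gauss_isoperimetric_def)
  ultimately show ?thesis
    by (simp cong: isCont_cong)
qed

lemma Gauss_isoperimetric_small:
  assumes "0 < e"
  obtains d where "0 < d" "\<And>t. t < d \<or> 1 - d < t \<Longrightarrow> Gauss_isoperimetric t < e"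
proof -
  have "(std_normal_density \<longlongrightarrow> 0) at_top"
    unfolding std_normal_density_def[abs_def] by real_asymp
  then have "eventually (\<lambda>x. std_normal_density x < e) at_top"
    using assms by (rule order_tendstoD(2))
  then obtain N where N: "\<And>x. N \<le> x \<Longrightarrow> std_normal_density x < e"
    by (auto simp: eventually_at_top_linorder)
  show ?thesis
  proof
    show "0 < Gauss_cdf (- N)" by (rule Gauss_cdf_bounds)
    fix t assume t: "t < Gauss_cdf (- N) \<or> 1 - Gauss_cdf (- N) < t"
    show "Gauss_isoperimetric t < e"
    proof (cases "0 < t \<and> t < 1")
      case True
      then obtain x where x: "Gauss_cdf x = t" using Gauss_cdf_surj by metis
      have "x < - N \<or> N < x"
        using t x Gauss_cdf_minus[of N] strict_mono_less[OF strict_mono_Gauss_cdf, of x "- N"]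
          strict_mono_less[OF strict_mono_Gauss_cdf, of N x] by auto
      then have "std_normal_density x < e"
        using N[of x] N[of "- x"] by auto
      then show ?thesis using x Gauss_isoperimetric_cdf by auto
    next
      case False
      then show ?thesis using assms by (auto simp: Gauss_isoperimetric_def)
    qed
  qed
qed

text \<open>The value 0 outside the open unit interval fits the limits at 0 and 1, so continuity
  holds on the whole line and limits can be taken without range conditions.\<close>

lemma isCont_Gauss_isoperimetric: "isCont Gauss_isoperimetric t"
proof (cases "0 < t \<and> t < 1")
  case False
  then have t: "t \<le> 0 \<or> 1 \<le> t" by auto
  show ?thesis
    unfolding continuous_at_eps_delta
  proof (intro allI impI)
    fix e :: real assume "0 < e"
    then obtain d where d: "0 < d" "\<And>s. s < d \<or> 1 - d < s \<Longrightarrow> Gauss_isoperimetric s < e"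
      using Gauss_isoperimetric_small by metis
    show "\<exists>d>0. \<forall>s. dist s t < d \<longrightarrow> dist (Gauss_isoperimetric s) (Gauss_isoperimetric t) < e"
    proof (intro exI[of _ d] conjI allI impI d)
      fix s assume "dist s t < d"
      then have "s < d \<or> 1 - d < s" using t by (auto simp: dist_real_def)
      moreover have "Gauss_isoperimetric t = 0" using t by (auto simp: Gauss_isoperimetric_def)
      ultimately show "dist (Gauss_isoperimetric s) (Gauss_isoperimetric t) < e"
        using d(2)[of s] Gauss_isoperimetric_nonneg[of s] by (simp add: dist_real_def)
    qed
  qed
qed (use isCont_Gauss_isoperimetric_inner in auto)

lemma borel_measurable_Gauss_isoperimetric [measurable]: "Gauss_isoperimetric \<in> borel_measurable borel"
  by (intro borel_measurable_continuous_onI continuous_at_imp_continuous_on ballI isCont_Gauss_isoperimetric)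

section \<open>A Bobkov inequality for commuting jumps\<close>

text \<open>Cauchy-Schwarz in the direct sum of the reals and the square-integrable functions, the
  latter weighted by \<open>t\<close>. With \<open>U\<close> and \<open>V\<close> the norms of
  \<open>(a, f)\<close> and \<open>(b, g)\<close>, the squared norm of
  \<open>V (a, f) - U (b, g)\<close> is \<open>2 U V\<close> times the difference of the two
  sides.\<close>

lemma Cauchy_Schwarz_direct_sum:
  fixes f g :: "'a \<Rightarrow> real"
  assumes "0 < a" "0 < b" "0 \<le> t"
    and [simp]: "integrable M (\<lambda>x. (f x)\<^sup>2)" "integrable M (\<lambda>x. (g x)\<^sup>2)" "integrable M (\<lambda>x. f x * g x)"
  shows "a * b + t * (\<integral>x. f x * g x \<partial>M)
    \<le> sqrt (a\<^sup>2 + t * (\<integral>x. (f x)\<^sup>2 \<partial>M)) * sqrt (b\<^sup>2 + t * (\<integral>x. (g x)\<^sup>2 \<partial>M))"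
proof -
  define U where "U = sqrt (a\<^sup>2 + t * (\<integral>x. (f x)\<^sup>2 \<partial>M))"
  define V where "V = sqrt (b\<^sup>2 + t * (\<integral>x. (g x)\<^sup>2 \<partial>M))"
  have f0: "0 \<le> t * (\<integral>x. (f x)\<^sup>2 \<partial>M)" and g0: "0 \<le> t * (\<integral>x. (g x)\<^sup>2 \<partial>M)"
    using assms by (auto intro!: mult_nonneg_nonneg integral_nonneg_AE)
  have U: "0 < U" "U\<^sup>2 = a\<^sup>2 + t * (\<integral>x. (f x)\<^sup>2 \<partial>M)"
    using f0 assms unfolding U_def by (auto intro!: add_pos_nonneg)
  have V: "0 < V" "V\<^sup>2 = b\<^sup>2 + t * (\<integral>x. (g x)\<^sup>2 \<partial>M)"
    using g0 assms unfolding V_def by (auto intro!: add_pos_nonneg)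
  have "0 \<le> (V * a - U * b)\<^sup>2 + t * (\<integral>x. (V * f x - U * g x)\<^sup>2 \<partial>M)"
    using assms by (intro add_nonneg_nonneg mult_nonneg_nonneg integral_nonneg_AE) auto
  also have "(\<lambda>x. (V * f x - U * g x)\<^sup>2) = (\<lambda>x. V\<^sup>2 * (f x)\<^sup>2 + U\<^sup>2 * (g x)\<^sup>2 - 2 * U * V * (f x * g x))"
    by (auto simp: power2_eq_square algebra_simps)
  also have "(\<integral>x. V\<^sup>2 * (f x)\<^sup>2 + U\<^sup>2 * (g x)\<^sup>2 - 2 * U * V * (f x * g x) \<partial>M)
      = V\<^sup>2 * (\<integral>x. (f x)\<^sup>2 \<partial>M) + U\<^sup>2 * (\<integral>x. (g x)\<^sup>2 \<partial>M) - 2 * U * V * (\<integral>x. f x * g x \<partial>M)"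
    by simp
  also have "(V * a - U * b)\<^sup>2 + t * (V\<^sup>2 * (\<integral>x. (f x)\<^sup>2 \<partial>M) + U\<^sup>2 * (\<integral>x. (g x)\<^sup>2 \<partial>M)
        - 2 * U * V * (\<integral>x. f x * g x \<partial>M))
      = V\<^sup>2 * (a\<^sup>2 + t * (\<integral>x. (f x)\<^sup>2 \<partial>M)) + U\<^sup>2 * (b\<^sup>2 + t * (\<integral>x. (g x)\<^sup>2 \<partial>M))
        - 2 * (U * V) * (a * b + t * (\<integral>x. f x * g x \<partial>M))"
    by (simp add: power2_eq_square algebra_simps)
  also have "\<dots> = 2 * (U * V) * (U * V - (a * b + t * (\<integral>x. f x * g x \<partial>M)))"
    unfolding U(2)[symmetric] V(2)[symmetric] by (simp add: power2_eq_square algebra_simps)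
  finally have "0 \<le> U * V - (a * b + t * (\<integral>x. f x * g x \<partial>M))"
    using mult_pos_pos[OF U(1) V(1)]
      zero_le_mult_iff[of "2 * (U * V)" "U * V - (a * b + t * (\<integral>x. f x * g x \<partial>M))"] by linarith
  then show ?thesis by (simp add: U_def V_def)
qed

section \<open>The Poisson limit of binomial averages\<close>

lemma binomial_sum_Suc:
  fixes a :: "nat \<Rightarrow> real"
  shows "(\<Sum>k\<le>Suc n. real (Suc n choose k) * p ^ (Suc n - k) * h ^ k * a k)
    = p * (\<Sum>k\<le>n. real (n choose k) * p ^ (n - k) * h ^ k * a k)
      + h * (\<Sum>k\<le>n. real (n choose k) * p ^ (n - k) * h ^ k * a (Suc k))"
proof -
  have "(\<Sum>k\<le>Suc n. real (Suc n choose k) * p ^ (Suc n - k) * h ^ k * a k)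
      = p ^ Suc n * a 0 + (\<Sum>k\<le>n. real (Suc n choose Suc k) * p ^ (n - k) * h ^ Suc k * a (Suc k))"
    by (subst sum.atMost_Suc_shift) simp
  also have "\<dots> = (p ^ Suc n * a 0 + (\<Sum>k\<le>n. real (n choose Suc k) * p ^ (n - k) * h ^ Suc k * a (Suc k)))
      + h * (\<Sum>k\<le>n. real (n choose k) * p ^ (n - k) * h ^ k * a (Suc k))"
    by (simp add: sum_distrib_left algebra_simps sum.distrib)
  also have "p ^ Suc n * a 0 + (\<Sum>k\<le>n. real (n choose Suc k) * p ^ (n - k) * h ^ Suc k * a (Suc k))
      = (\<Sum>k\<le>Suc n. real (n choose k) * p ^ (Suc n - k) * h ^ k * a k)"
    by (subst sum.atMost_Suc_shift) simp
  also have "\<dots> = (\<Sum>k\<le>n. real (n choose k) * p ^ (Suc n - k) * h ^ k * a k)"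
    by simp
  also have "\<dots> = p * (\<Sum>k\<le>n. real (n choose k) * p ^ (n - k) * h ^ k * a k)"
    by (auto simp: sum_distrib_left Suc_diff_le intro!: sum.cong)
  finally show ?thesis .
qed

lemma tendsto_binomial_over_power:
  "(\<lambda>n. real (n choose k) / real n ^ k) \<longlonglongrightarrow> 1 / fact k"
proof -
  have "(\<lambda>n. (\<Prod>i<k. 1 - real i / real n) / fact k) \<longlonglongrightarrow> (\<Prod>i<k. 1 - 0) / fact k"
    by (intro tendsto_intros lim_const_over_n) auto
  moreover have "eventually (\<lambda>n. (\<Prod>i<k. 1 - real i / real n) / fact k = real (n choose k) / real n ^ k) sequentially"
  proof (rule eventually_sequentiallyI[of "Suc k"])
    fix n assume n: "Suc k \<le> n"
    have "real (n choose k) = (\<Prod>i<k. real n - real i) / fact k"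
      using n by (simp add: binomial_gbinomial gbinomial_prod_rev atLeast0LessThan)
    moreover have "(\<Prod>i<k. 1 - real i / real n) = (\<Prod>i<k. (real n - real i) / real n)"
      using n by (intro prod.cong) (auto simp: field_simps)
    moreover have "\<dots> = (\<Prod>i<k. real n - real i) / real n ^ k"
      by (simp add: prod_dividef)
    ultimately show "(\<Prod>i<k. 1 - real i / real n) / fact k = real (n choose k) / real n ^ k"
      by simp
  qed
  ultimately show ?thesis
    by (auto intro: Lim_transform_eventually)
qed

lemma binomial_over_power_le: "real (n choose k) / real n ^ k \<le> 1 / fact k"
proof (cases "n = 0")
  case False
  have "real (n choose k) * fact k \<le> real n ^ k"
    using binomial_fact_pow[of n k] by (metis of_nat_fact of_nat_le_iff of_nat_mult of_nat_power)
  then show ?thesis using False by (simp add: field_simps)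
qed (cases k; simp)

text \<open>The law of small numbers, with the factor \<open>m ^ k\<close> of the weights absorbed
  into \<open>a k\<close>: the coefficients will be iterates of an operator of norm at most
  \<open>m\<close>. Tannery's theorem exchanges limit and sum under the majorant
  \<open>K * m ^ k / fact k\<close>.\<close>

lemma tendsto_binomial_average:
  fixes a :: "nat \<Rightarrow> real"
  assumes m: "0 \<le> m" and a: "\<And>k. \<bar>a k\<bar> \<le> K * m ^ k"
  shows "(\<lambda>n. \<Sum>k\<le>n. real (n choose k) * (1 - 1 / real n * m) ^ (n - k) * (1 / real n) ^ k * a k)
    \<longlonglongrightarrow> (\<Sum>k. exp (- m) / fact k * a k)"
proof -
  define b where "b k n = real (n choose k) / real n ^ k * (1 - m / real n) ^ (n - k) * a k" for k n
  have K: "0 \<le> K" using a[of 0] by simp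
  have lim: "(\<lambda>n. b k n) \<longlonglongrightarrow> exp (- m) / fact k * a k" for k
  proof -
    have "(\<lambda>n. (1 + (- m) / real n) ^ n / (1 - m / real n) ^ k) \<longlonglongrightarrow> exp (- m) / (1 - 0) ^ k"
      by (intro tendsto_intros tendsto_exp_limit_sequentially lim_const_over_n) auto
    moreover have "eventually (\<lambda>n. (1 + (- m) / real n) ^ n / (1 - m / real n) ^ k
        = (1 - m / real n) ^ (n - k)) sequentially"
      using eventually_gt_at_top[of k] eventually_gt_at_top[of "nat \<lceil>m\<rceil>"]
    proof eventually_elim
      case (elim n)
      then have "m < real n" by linarith
      then have "1 - m / real n \<noteq> 0" using m by (auto simp: field_simps)
      then show ?case using elim by (simp add: power_diff)
    qed
    ultimately have "(\<lambda>n. (1 - m / real n) ^ (n - k)) \<longlonglongrightarrow> exp (- m)"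
      using Lim_transform_eventually by fastforce
    then have "(\<lambda>n. real (n choose k) / real n ^ k * (1 - m / real n) ^ (n - k) * a k)
        \<longlonglongrightarrow> 1 / fact k * exp (- m) * a k"
      by (intro tendsto_intros tendsto_binomial_over_power)
    then show ?thesis by (simp add: b_def)
  qed
  have bound: "norm (b k n) \<le> K * (m ^ k / fact k)" if "m \<le> real n" "0 < n" for k n
  proof -
    have "0 \<le> 1 - m / real n" "1 - m / real n \<le> 1" using that m by (auto simp: field_simps)
    then have "\<bar>(1 - m / real n) ^ (n - k)\<bar> \<le> 1" by (simp add: power_le_one)
    then have "\<bar>b k n\<bar> \<le> (1 / fact k) * 1 * (K * m ^ k)"
      unfolding b_def abs_mult
      using binomial_over_power_le[of n k] a[of k] by (intro mult_mono) auto
    then show ?thesis by simp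
  qed
  \<comment> \<open>The majorant holds for large n only: \<open>1 - m / real n\<close> lies in the
    unit interval once \<open>n\<close> is positive and at least \<open>m\<close>.\<close>
  have "eventually (\<lambda>(k, n). norm (b k n) \<le> K * (m ^ k / fact k)) (at_top \<times>\<^sub>F sequentially)"
  proof -
    have "eventually (\<lambda>n. m \<le> real n \<and> 0 < n) sequentially"
      using eventually_gt_at_top[of "nat \<lceil>m\<rceil>"] by eventually_elim linarith
    then show ?thesis
      using eventually_prodI[of "\<lambda>_. True" at_top "\<lambda>n. m \<le> real n \<and> 0 < n" sequentially] bound
      by (auto elim!: eventually_mono)
  qed
  moreover have "summable (\<lambda>k. K * (m ^ k / fact k))"
    using summable_exp[of m] by (intro summable_mult) (simp add: field_simps)
  ultimately have "(\<lambda>n. \<Sum>k. b k n) \<longlonglongrightarrow> (\<Sum>k. exp (- m) / fact k * a k)"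
    using tannerys_theorem[OF lim, where M = "\<lambda>k. K * (m ^ k / fact k)"] by auto
  moreover have "(\<Sum>k. b k n) = (\<Sum>k\<le>n. real (n choose k) * (1 - 1 / real n * m) ^ (n - k) * (1 / real n) ^ k * a k)" for n
    by (subst suminf_finite[of "{..n}"]) (auto simp: b_def power_one_over divide_simps intro!: sum.cong)
  ultimately show ?thesis by simp
qed

section \<open>Operators of a jump chain with commuting jumps\<close>

locale commuting_jumps = finite_measure \<sigma> for \<sigma> :: "'x measure" +
  fixes S :: "'s measure" and \<tau> :: "'x \<Rightarrow> 's \<Rightarrow> 's"
  assumes measurable_jump: "case_prod \<tau> \<in> \<sigma> \<Otimes>\<^sub>M S \<rightarrow>\<^sub>M S"
    and jump_commute: "\<tau> x (\<tau> y s) = \<tau> y (\<tau> x s)"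
    and space_jumps [simp]: "space \<sigma> = UNIV"
    and space_states [simp]: "space S = UNIV"
begin

definition mass :: real where "mass = measure \<sigma> UNIV"

definition jump_int :: "('s \<Rightarrow> real) \<Rightarrow> 's \<Rightarrow> real" where
  "jump_int G s = (\<integral>x. G (\<tau> x s) \<partial>\<sigma>)"

text \<open>This is \<open>1 + h L\<close> for the generator \<open>L = jump_int - mass\<close> of
  the chain in which \<open>s\<close> jumps to \<open>\<tau> x s\<close> at rate
  \<open>\<sigma>(dx)\<close>. It is a Markov operator when \<open>0 \<le> h\<close> and
  \<open>h * mass \<le> 1\<close>, which is why these two conditions recur below.\<close>

definition step :: "real \<Rightarrow> ('s \<Rightarrow> real) \<Rightarrow> 's \<Rightarrow> real" where
  "step h G s = (1 - h * mass) * G s + h * jump_int G s"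

definition sq_grad :: "('s \<Rightarrow> real) \<Rightarrow> 's \<Rightarrow> real" where
  "sq_grad G s = (\<integral>x. (G (\<tau> x s) - G s)\<^sup>2 \<partial>\<sigma>)"

definition bdd_meas :: "('s \<Rightarrow> real) \<Rightarrow> bool" where
  "bdd_meas G \<longleftrightarrow> G \<in> borel_measurable S \<and> (\<exists>K. \<forall>s. \<bar>G s\<bar> \<le> K)"

lemma measurable_jump' [measurable (raw)]:
  assumes [measurable]: "f \<in> N \<rightarrow>\<^sub>M \<sigma>" "g \<in> N \<rightarrow>\<^sub>M S"
  shows "(\<lambda>w. \<tau> (f w) (g w)) \<in> N \<rightarrow>\<^sub>M S"
proof -
  have "(\<lambda>w. case_prod \<tau> (f w, g w)) \<in> N \<rightarrow>\<^sub>M S"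
    by (rule measurable_compose[OF _ measurable_jump]) measurable
  then show ?thesis by simp
qed

lemma measurable_state_const [measurable]: "(\<lambda>_. s) \<in> N \<rightarrow>\<^sub>M S"
  by (rule measurable_const) simp

lemma bdd_measD: "bdd_meas G \<Longrightarrow> G \<in> borel_measurable S"
  by (simp add: bdd_meas_def)

lemma bdd_measI:
  assumes "G \<in> borel_measurable S" "\<And>s. \<bar>G s\<bar> \<le> K"
  shows "bdd_meas G"
  using assms by (auto simp: bdd_meas_def)

lemma bdd_meas_bound:
  assumes "bdd_meas G" obtains K where "0 \<le> K" "\<And>s. \<bar>G s\<bar> \<le> K"
proof -
  obtain K where K: "\<And>s. \<bar>G s\<bar> \<le> K" using assms by (auto simp: bdd_meas_def)
  then have "0 \<le> K" by (meson abs_ge_zero order_trans)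
  then show ?thesis using K that by blast
qed

lemma mass_nonneg [simp]: "0 \<le> mass"
  by (simp add: mass_def)

lemma integrable_bounded:
  fixes f :: "'x \<Rightarrow> real"
  assumes "f \<in> borel_measurable \<sigma>" "\<And>x. \<bar>f x\<bar> \<le> K"
  shows "integrable \<sigma> f"
  using assms by (intro integrable_const_bound[of _ K]) auto

lemma integral_bounds:
  fixes f :: "'x \<Rightarrow> real"
  assumes "integrable \<sigma> f" "\<And>x. a \<le> f x" "\<And>x. f x \<le> b"
  shows "a * mass \<le> (\<integral>x. f x \<partial>\<sigma>)" "(\<integral>x. f x \<partial>\<sigma>) \<le> b * mass"
proof -
  have "(\<integral>x. a \<partial>\<sigma>) \<le> (\<integral>x. f x \<partial>\<sigma>)" "(\<integral>x. f x \<partial>\<sigma>) \<le> (\<integral>x. b \<partial>\<sigma>)"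
    by (intro integral_mono; simp add: assms)+
  then show "a * mass \<le> (\<integral>x. f x \<partial>\<sigma>)" "(\<integral>x. f x \<partial>\<sigma>) \<le> b * mass"
    by (auto simp: mass_def mult.commute)
qed

lemma integrable_jump [simp]:
  assumes "bdd_meas G"
  shows "integrable \<sigma> (\<lambda>x. G (\<tau> x s))"
proof -
  note assms[THEN bdd_measD, measurable]
  obtain K where "\<And>s. \<bar>G s\<bar> \<le> K" using bdd_meas_bound[OF assms] by metis
  then show ?thesis by (intro integrable_bounded[of _ K]) auto
qed

lemma bdd_meas_lincomb:
  assumes "bdd_meas F" "bdd_meas G"
  shows "bdd_meas (\<lambda>s. a * F s + b * G s)"
proof -
  note assms[THEN bdd_measD, measurable]
  obtain K L where "\<And>s. \<bar>F s\<bar> \<le> K" "\<And>s. \<bar>G s\<bar> \<le> L"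
    using bdd_meas_bound[OF assms(1)] bdd_meas_bound[OF assms(2)] by metis
  then have "\<bar>a * F s + b * G s\<bar> \<le> \<bar>a\<bar> * K + \<bar>b\<bar> * L" for s
    by (intro order_trans[OF abs_triangle_ineq] add_mono) (auto simp: abs_mult intro!: mult_left_mono)
  then show ?thesis by (intro bdd_measI) auto
qed

lemma abs_jump_int_le:
  assumes "bdd_meas G" "\<And>s. \<bar>G s\<bar> \<le> K"
  shows "\<bar>jump_int G s\<bar> \<le> K * mass"
  using integral_bounds[OF integrable_jump[OF assms(1)], of "- K" s K] assms(2)
  unfolding jump_int_def by (auto simp: abs_le_iff minus_le_iff)

lemma bdd_meas_jump_int:
  assumes "bdd_meas G"
  shows "bdd_meas (jump_int G)"
proof -
  note assms[THEN bdd_measD, measurable]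
  obtain K where K: "\<And>s. \<bar>G s\<bar> \<le> K" using bdd_meas_bound[OF assms] by metis
  have "(\<lambda>s. \<integral>x. G (\<tau> x s) \<partial>\<sigma>) \<in> borel_measurable S" by measurable
  then show ?thesis
    using abs_jump_int_le[OF assms K] unfolding jump_int_def[abs_def] by (intro bdd_measI)
qed

lemma bdd_meas_step: "bdd_meas G \<Longrightarrow> bdd_meas (step h G)"
  unfolding step_def[abs_def] by (intro bdd_meas_lincomb bdd_meas_jump_int)

lemma bdd_meas_steps: "bdd_meas G \<Longrightarrow> bdd_meas ((step h ^^ n) G)"
  by (induction n) (auto intro: bdd_meas_step)

lemma bdd_meas_jump_ints: "bdd_meas G \<Longrightarrow> bdd_meas ((jump_int ^^ n) G)"
  by (induction n) (auto intro: bdd_meas_jump_int)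

lemma abs_jump_ints_le:
  assumes "bdd_meas G" "\<And>s. \<bar>G s\<bar> \<le> K"
  shows "\<bar>(jump_int ^^ n) G s\<bar> \<le> K * mass ^ n"
proof (induction n arbitrary: s)
  case (Suc n)
  then show ?case
    using abs_jump_int_le[OF bdd_meas_jump_ints[OF assms(1)], of n "K * mass ^ n" s] by (simp add: mult_ac)
qed (simp add: assms)

lemma integrable_sq_grad:
  assumes "bdd_meas G"
  shows "integrable \<sigma> (\<lambda>x. (G (\<tau> x s) - G s)\<^sup>2)"
proof -
  note assms[THEN bdd_measD, measurable]
  obtain K where K: "\<And>s. \<bar>G s\<bar> \<le> K" using bdd_meas_bound[OF assms] by metis
  have "\<bar>G (\<tau> x s) - G s\<bar> \<le> \<bar>2 * K\<bar>" for x
    using K[of "\<tau> x s"] K[of s] by linarith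
  then have "\<bar>(G (\<tau> x s) - G s)\<^sup>2\<bar> \<le> (2 * K)\<^sup>2" for x
    unfolding abs_power2 by (rule abs_le_square_iff[THEN iffD1])
  then show ?thesis by (intro integrable_bounded) auto
qed

lemma sq_grad_nonneg: "0 \<le> sq_grad G s"
  unfolding sq_grad_def by (intro integral_nonneg_AE) auto

lemma sq_grad_le:
  assumes "bdd_meas G" "\<And>s s'. \<bar>G s - G s'\<bar> \<le> K"
  shows "sq_grad G s \<le> K\<^sup>2 * mass"
proof -
  have "(G s - G s')\<^sup>2 \<le> K\<^sup>2" for s s'
    using assms(2)[of s s'] by (auto simp: abs_le_square_iff[symmetric])
  then show ?thesis
    unfolding sq_grad_def by (intro integral_bounds(2)[of _ 0] integrable_sq_grad assms) auto
qed

lemma bdd_meas_sq_grad: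
  assumes "bdd_meas G"
  shows "bdd_meas (sq_grad G)"
proof -
  note assms[THEN bdd_measD, measurable]
  obtain K where K: "\<And>s. \<bar>G s\<bar> \<le> K" using bdd_meas_bound[OF assms] by metis
  have "\<bar>G s - G s'\<bar> \<le> 2 * K" for s s'
    using K[of s] K[of s'] by linarith
  then have "sq_grad G s \<le> (2 * K)\<^sup>2 * mass" for s
    by (intro sq_grad_le assms)
  moreover have "(\<lambda>s. \<integral>x. (G (\<tau> x s) - G s)\<^sup>2 \<partial>\<sigma>) \<in> borel_measurable S" by measurable
  ultimately show ?thesis
    using sq_grad_nonneg by (intro bdd_measI[of _ "(2 * K)\<^sup>2 * mass"]) (auto simp: sq_grad_def[abs_def])
qed

lemma bdd_meas_Gauss_isoperimetric:
  assumes "bdd_meas G"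
  shows "bdd_meas (\<lambda>s. Gauss_isoperimetric (G s))"
proof -
  note assms[THEN bdd_measD, measurable]
  show ?thesis
    by (rule bdd_measI[of _ 1])
      (use Gauss_isoperimetric_nonneg Gauss_isoperimetric_le_1 in auto)
qed

lemma bdd_meas_sqrt:
  assumes "bdd_meas P" "bdd_meas G" "0 \<le> t"
  shows "bdd_meas (\<lambda>s. sqrt ((P s)\<^sup>2 + t * sq_grad G s))"
proof -
  note assms(1,2)[THEN bdd_measD, measurable] bdd_meas_sq_grad[OF assms(2), THEN bdd_measD, measurable]
  obtain K where K: "\<And>s. \<bar>P s\<bar> \<le> K" using bdd_meas_bound[OF assms(1)] by metis
  obtain L where L: "\<And>s. \<bar>sq_grad G s\<bar> \<le> L" using bdd_meas_bound[OF bdd_meas_sq_grad[OF assms(2)]] by metis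
  have "sqrt ((P s)\<^sup>2 + t * sq_grad G s) \<le> sqrt (K\<^sup>2 + t * L)" for s
    using K[of s] L[of s] assms(3) by (intro real_sqrt_le_mono add_mono mult_left_mono) (auto simp: abs_le_square_iff[symmetric])
  moreover have "0 \<le> (P s)\<^sup>2 + t * sq_grad G s" for s
    using assms(3) sq_grad_nonneg by auto
  ultimately show ?thesis
    by (intro bdd_measI[of _ "sqrt (K\<^sup>2 + t * L)"]) auto
qed

lemma step_lincomb:
  assumes "bdd_meas F" "bdd_meas G"
  shows "step h (\<lambda>s. a * F s + b * G s) s = a * step h F s + b * step h G s"
  using assms by (simp add: step_def jump_int_def algebra_simps)

lemma jump_int_const: "jump_int (\<lambda>_. k) s = k * mass"
  by (simp add: jump_int_def mass_def mult.commute)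

lemma step_const: "step h (\<lambda>_. k) s = k"
  by (simp add: step_def jump_int_const algebra_simps)

lemma bdd_meas_const: "bdd_meas (\<lambda>_. k)"
  by (rule bdd_measI[of _ "\<bar>k\<bar>"]) auto

lemma step_add_const:
  assumes "bdd_meas F"
  shows "step h (\<lambda>s. F s + k) s = step h F s + k"
  using step_lincomb[OF assms bdd_meas_const, of h 1 1 k s] by (simp add: step_const)

lemma step_mono:
  assumes "bdd_meas F" "bdd_meas G" "\<And>s. F s \<le> G s" "0 \<le> h" "h * mass \<le> 1"
  shows "step h F s \<le> step h G s"
  unfolding step_def jump_int_def using assms
  by (intro add_mono mult_left_mono integral_mono) auto

lemma steps_mono:
  assumes "bdd_meas F" "bdd_meas G" "\<And>s. F s \<le> G s" "0 \<le> h" "h * mass \<le> 1"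
  shows "(step h ^^ n) F s \<le> (step h ^^ n) G s"
  using assms by (induction n arbitrary: s) (auto intro!: step_mono bdd_meas_steps)

lemma steps_add_const:
  assumes "bdd_meas F"
  shows "(step h ^^ n) (\<lambda>s. F s + k) = (\<lambda>s. (step h ^^ n) F s + k)"
proof (induction n)
  case (Suc n)
  show ?case
    by (rule ext) (simp add: Suc step_add_const[OF bdd_meas_steps[OF assms]])
qed simp

lemma step_bounds:
  assumes "bdd_meas G" "\<And>s. a \<le> G s" "\<And>s. G s \<le> b" "0 \<le> h" "h * mass \<le> 1"
  shows "a \<le> step h G s" "step h G s \<le> b"
  using step_mono[of "\<lambda>_. a" G h s] step_mono[of G "\<lambda>_. b" h s] assms
  by (auto simp: bdd_meas_const step_const)

lemma bdd_meas_jump: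
  assumes "bdd_meas G"
  shows "bdd_meas (\<lambda>s. G (\<tau> x s))"
proof -
  note assms[THEN bdd_measD, measurable]
  obtain K where K: "\<And>s. \<bar>G s\<bar> \<le> K" using bdd_meas_bound[OF assms] by metis
  have [measurable]: "(\<lambda>_. x) \<in> S \<rightarrow>\<^sub>M \<sigma>" by (rule measurable_const) simp
  show ?thesis using K by (intro bdd_measI[of _ K]) auto
qed

text \<open>Commutation of the jumps enters here and nowhere else: a point may be added before or
  after the step. By linearity the difference operator then commutes with
  \<open>step h\<close>.\<close>

lemma step_jump: "step h G (\<tau> x s) = step h (\<lambda>s. G (\<tau> x s)) s"
  by (simp add: step_def jump_int_def jump_commute)

lemma step_diff_jump:
  assumes "bdd_meas G"
  shows "step h G (\<tau> x s) - step h G s = step h (\<lambda>s. G (\<tau> x s) - G s) s"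
  using step_lincomb[OF bdd_meas_jump[OF assms] assms, of h 1 x "-1" s]
  by (simp add: step_jump)

text \<open>Minkowski's inequality, in the dual form obtained by pairing with the vector on the left.\<close>

lemma step_Minkowski:
  assumes P: "bdd_meas P" "0 < c" "\<And>s. c \<le> P s" and G: "bdd_meas G"
    and h: "0 \<le> h" "h * mass \<le> 1" and t: "0 \<le> t"
  shows "sqrt ((step h P s)\<^sup>2 + t * sq_grad (step h G) s)
    \<le> step h (\<lambda>s. sqrt ((P s)\<^sup>2 + t * sq_grad G s)) s"
proof -
  note P(1)[THEN bdd_measD, measurable] G[THEN bdd_measD, measurable] bdd_meas_step[OF G, THEN bdd_measD, measurable]
  obtain K where K: "0 \<le> K" "\<And>s. \<bar>G s\<bar> \<le> K" using bdd_meas_bound[OF G] by metis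
  obtain L where L: "0 \<le> L" "\<And>s. \<bar>step h G s\<bar> \<le> L" using bdd_meas_bound[OF bdd_meas_step[OF G]] by metis
  define a where "a = step h P s"
  \<comment> \<open>The pair \<open>(a, \<beta>)\<close> is the vector whose norm \<open>W\<close>
    is the left-hand side. At a state \<open>r\<close>, \<open>V r\<close> is the pairing of
    \<open>\<beta>\<close> with the gradient \<open>D _ r\<close>, and \<open>U r\<close> is the
    norm of the vector \<open>(P r, D _ r)\<close>.\<close>
  define \<beta> where "\<beta> x = step h G (\<tau> x s) - step h G s" for x
  define D where "D x r = G (\<tau> x r) - G r" for x r
  define W where "W = sqrt (a\<^sup>2 + t * sq_grad (step h G) s)"
  define U where "U r = sqrt ((P r)\<^sup>2 + t * sq_grad G r)" for r
  define V where "V r = (\<integral>x. \<beta> x * D x r \<partial>\<sigma>)" for r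
  have [measurable]: "\<beta> \<in> borel_measurable \<sigma>" unfolding \<beta>_def[abs_def] by measurable
  have \<beta>: "\<bar>\<beta> x\<bar> \<le> 2 * L" for x
    unfolding \<beta>_def using L(2)[of "\<tau> x s"] L(2)[of s] by linarith
  have D: "\<bar>D x r\<bar> \<le> 2 * K" for x r
    unfolding D_def using K(2)[of "\<tau> x r"] K(2)[of r] by linarith
  have \<beta>D: "\<bar>\<beta> x * D x r\<bar> \<le> (2 * L) * (2 * K)" for x r
    unfolding abs_mult using \<beta> D K(1) L(1) by (intro mult_mono) auto
  have D_meas [measurable]: "(\<lambda>w. D (f w) (g w)) \<in> borel_measurable N"
    if [measurable]: "f \<in> N \<rightarrow>\<^sub>M \<sigma>" "g \<in> N \<rightarrow>\<^sub>M S" for f g N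
    unfolding D_def[abs_def] by measurable
  have int\<beta>D: "integrable \<sigma> (\<lambda>x. \<beta> x * D x r)" for r
    by (rule integrable_bounded[OF _ \<beta>D]) measurable
  have bddV: "bdd_meas V"
  proof (rule bdd_measI)
    show "V \<in> borel_measurable S" unfolding V_def[abs_def] by measurable
    fix r
    have "- ((2 * L) * (2 * K)) \<le> \<beta> x * D x r" "\<beta> x * D x r \<le> (2 * L) * (2 * K)" for x
      using \<beta>D[of x r] by auto
    from integral_bounds[OF int\<beta>D this]
    show "\<bar>V r\<bar> \<le> (2 * L) * (2 * K) * mass"
      unfolding V_def by (auto simp: abs_le_iff minus_le_iff)
  qed
  have a: "0 < a"
    unfolding a_def using step_mono[OF bdd_meas_const P(1) P(3) h, of s] P(2)
    by (simp add: step_const)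
  have W2: "W\<^sup>2 = a\<^sup>2 + t * sq_grad (step h G) s"
    unfolding W_def using t sq_grad_nonneg by simp
  have W: "0 < W"
    unfolding W_def using a t sq_grad_nonneg by (auto intro!: add_pos_nonneg)
  have CS: "a * P r + t * V r \<le> W * U r" for r
    unfolding W_def U_def V_def sq_grad_def \<beta>_def[symmetric] D_def[symmetric]
  proof (rule Cauchy_Schwarz_direct_sum)
    show "0 < P r" using P(2,3) less_le_trans by blast
    show "integrable \<sigma> (\<lambda>x. (\<beta> x)\<^sup>2)"
      unfolding \<beta>_def by (rule integrable_sq_grad[OF bdd_meas_step[OF G]])
    show "integrable \<sigma> (\<lambda>x. (D x r)\<^sup>2)"
      unfolding D_def by (rule integrable_sq_grad[OF G])
  qed (use a t int\<beta>D in auto)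
  \<comment> \<open>Fubini moves the step inside the pairing. There it acts on \<open>D x\<close>,
    and as it commutes with differences it returns \<open>\<beta> x\<close>; hence
    \<open>step h V s\<close> is the squared norm of \<open>\<beta>\<close>.\<close>
  have "(\<integral>y. V (\<tau> y s) \<partial>\<sigma>) = (\<integral>x. (\<integral>y. \<beta> x * D x (\<tau> y s) \<partial>\<sigma>) \<partial>\<sigma>)"
  proof -
    interpret pair_sigma_finite \<sigma> \<sigma>
      by (simp add: pair_sigma_finite_def sigma_finite_measure_axioms)
    interpret P: finite_measure "\<sigma> \<Otimes>\<^sub>M \<sigma>"
      by (rule finite_measure_pair_measure) (rule finite_measure_axioms)+
    have "integrable (\<sigma> \<Otimes>\<^sub>M \<sigma>) (\<lambda>(y, x). \<beta> x * D x (\<tau> y s))"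
      using \<beta>D by (intro P.integrable_const_bound[of _ "(2 * L) * (2 * K)"]) (auto simp: split_beta)
    then show ?thesis
      unfolding V_def by (rule Fubini_integral[symmetric])
  qed
  also have "\<dots> = (\<integral>x. \<beta> x * (\<integral>y. D x (\<tau> y s) \<partial>\<sigma>) \<partial>\<sigma>)" by simp
  finally have VF: "jump_int V s = (\<integral>x. \<beta> x * (\<integral>y. D x (\<tau> y s) \<partial>\<sigma>) \<partial>\<sigma>)"
    by (simp add: jump_int_def)
  have int2: "integrable \<sigma> (\<lambda>x. \<beta> x * (\<integral>y. D x (\<tau> y s) \<partial>\<sigma>))"
  proof (rule integrable_bounded)
    fix x
    have "bdd_meas (D x)"
      unfolding D_def[abs_def] using bdd_meas_lincomb[OF bdd_meas_jump[OF G] G, of 1 x "-1"] by simp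
    then have "\<bar>\<integral>y. D x (\<tau> y s) \<partial>\<sigma>\<bar> \<le> 2 * K * mass"
      using abs_jump_int_le[of "D x" "2 * K" s] D by (simp add: jump_int_def)
    then show "\<bar>\<beta> x * (\<integral>y. D x (\<tau> y s) \<partial>\<sigma>)\<bar> \<le> 2 * L * (2 * K * mass)"
      unfolding abs_mult using \<beta> K(1) L(1) by (intro mult_mono) auto
  qed measurable
  have "step h V s = (\<integral>x. (1 - h * mass) * (\<beta> x * D x s) + h * (\<beta> x * (\<integral>y. D x (\<tau> y s) \<partial>\<sigma>)) \<partial>\<sigma>)"
    unfolding step_def VF using int\<beta>D[of s] int2 by (simp add: V_def)
  also have "\<dots> = (\<integral>x. (\<beta> x)\<^sup>2 \<partial>\<sigma>)"
  proof (rule Bochner_Integration.integral_cong[OF refl])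
    fix x
    have "\<beta> x = step h (D x) s"
      unfolding \<beta>_def D_def[abs_def] by (rule step_diff_jump[OF G])
    then have \<beta>_eq: "(1 - h * mass) * D x s + h * (\<integral>y. D x (\<tau> y s) \<partial>\<sigma>) = \<beta> x"
      by (simp add: step_def jump_int_def)
    have "(1 - h * mass) * (\<beta> x * D x s) + h * (\<beta> x * (\<integral>y. D x (\<tau> y s) \<partial>\<sigma>))
        = \<beta> x * ((1 - h * mass) * D x s + h * (\<integral>y. D x (\<tau> y s) \<partial>\<sigma>))"
      by (simp add: algebra_simps)
    then show "(1 - h * mass) * (\<beta> x * D x s) + h * (\<beta> x * (\<integral>y. D x (\<tau> y s) \<partial>\<sigma>)) = (\<beta> x)\<^sup>2"
      unfolding \<beta>_eq power2_eq_square .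
  qed
  finally have stepV: "step h V s = sq_grad (step h G) s"
    by (simp add: sq_grad_def \<beta>_def)
  have bddU: "bdd_meas U" unfolding U_def[abs_def] by (rule bdd_meas_sqrt[OF P(1) G t])
  \<comment> \<open>The squared norm is a pairing, the pairing is the step of the pairings at single
    states, and Cauchy-Schwarz bounds each of these by \<open>W * U r\<close>. Dividing by
    \<open>W\<close> is possible since \<open>P\<close> is bounded below. The summand
    \<open>0 * U r\<close> only gives the bound the shape of a linear combination.\<close>
  have "W * W = a * step h P s + t * step h V s"
    using W2 by (simp add: stepV a_def power2_eq_square)
  also have "\<dots> = step h (\<lambda>r. a * P r + t * V r) s"
    by (rule step_lincomb[symmetric]) (rule P(1) bddV)+
  also have "\<dots> \<le> step h (\<lambda>r. W * U r + 0 * U r) s"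
    using CS by (intro step_mono bdd_meas_lincomb P bddV bddU h) auto
  also have "\<dots> = W * step h U s"
    by (subst step_lincomb[OF bddU bddU]) simp
  finally have "W \<le> step h U s" using W by simp
  then show ?thesis unfolding W_def U_def a_def .
qed

text \<open>The tangent bounds \<open>I\<close> of the step from above, the quadratic bound
  estimates the step of \<open>I\<close> from below, and both contain the same linear term
  \<open>- J * h * \<Delta>\<close>. It cancels and leaves \<open>I q \<le> w + h * (g / b)\<close>.
  On squaring, \<open>w\<close> is at most \<open>b + h * mass\<close>, so the mixed term gives
  \<open>2 h g\<close> up to second order. Of the constants, 8 comes from passing to the gradient
  after the step, \<open>2 / c\<close> from \<open>h * mass\<close> in the bound for
  \<open>w\<close>, and \<open>1 / c^2\<close> from the square of
  \<open>h * (g / b)\<close>.\<close>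

lemma step_Gauss_isoperimetric:
  assumes G: "bdd_meas G" "\<And>s. e \<le> G s" "\<And>s. G s \<le> 1 - e" and e: "0 < e"
    and c: "0 < c" "\<And>t. e \<le> t \<Longrightarrow> t \<le> 1 - e \<Longrightarrow> c \<le> Gauss_isoperimetric t"
    and h: "0 \<le> h" "h * mass \<le> 1"
  shows "(Gauss_isoperimetric (step h G s))\<^sup>2
    \<le> (step h (\<lambda>s. Gauss_isoperimetric (G s)) s)\<^sup>2 + 2 * h * sq_grad (step h G) s
      + (8 * mass\<^sup>2 + 2 * mass\<^sup>2 / c + mass\<^sup>2 / c\<^sup>2) * h\<^sup>2"
proof -
  define b where "b = Gauss_isoperimetric (G s)"
  define q where "q = step h G s"
  define w where "w = step h (\<lambda>s. Gauss_isoperimetric (G s)) s"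
  define g where "g = sq_grad G s"
  define J where "J = inv Gauss_cdf (G s)"
  define \<Delta> where "\<Delta> = (\<integral>x. G (\<tau> x s) - G s \<partial>\<sigma>)"
  have I: "bdd_meas (\<lambda>s. Gauss_isoperimetric (G s))"
    by (rule bdd_meas_Gauss_isoperimetric[OF G(1)])
  have unit: "0 < G r" "G r < 1" for r
    using G(2,3)[of r] e by auto
  have b: "c \<le> b" "b \<le> 1" "0 < b"
    using c G(2,3) less_le_trans[OF c(1)] by (auto simp: b_def Gauss_isoperimetric_le_1)
  have step_eq: "step h F s = F s + h * (\<integral>x. F (\<tau> x s) - F s \<partial>\<sigma>)" if "bdd_meas F" for F
    using that by (simp add: step_def jump_int_def mass_def algebra_simps)
  have q: "q = G s + h * \<Delta>"
    unfolding q_def \<Delta>_def by (rule step_eq[OF G(1)])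
  have q_unit: "0 < q" "q < 1"
    using step_bounds[OF G h, of s] e by (auto simp: q_def)
  have diff: "\<bar>G r - G r'\<bar> \<le> 1" for r r'
    using G(2,3)[of r] G(2,3)[of r'] e by (auto simp: abs_le_iff)
  have g: "0 \<le> g" "g \<le> mass"
    using sq_grad_nonneg sq_grad_le[OF G(1) diff] by (auto simp: g_def)
  have intd: "integrable \<sigma> (\<lambda>x. G (\<tau> x s) - G s)"
    using G by simp
  have int2: "integrable \<sigma> (\<lambda>x. (G (\<tau> x s) - G s)\<^sup>2)"
    by (rule integrable_sq_grad[OF G(1)])
  have "- J * \<Delta> - g / b = (\<integral>x. - J * (G (\<tau> x s) - G s) - (G (\<tau> x s) - G s)\<^sup>2 / b \<partial>\<sigma>)"
    unfolding \<Delta>_def g_def sq_grad_def using intd int2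
    by (subst Bochner_Integration.integral_diff) auto
  also have "\<dots> \<le> (\<integral>x. Gauss_isoperimetric (G (\<tau> x s)) - Gauss_isoperimetric (G s) \<partial>\<sigma>)"
  proof (rule integral_mono)
    show "integrable \<sigma> (\<lambda>x. - J * (G (\<tau> x s) - G s) - (G (\<tau> x s) - G s)\<^sup>2 / b)"
      using intd int2 by simp
    show "integrable \<sigma> (\<lambda>x. Gauss_isoperimetric (G (\<tau> x s)) - Gauss_isoperimetric (G s))"
      using integrable_jump[OF I] by simp
    show "- J * (G (\<tau> x s) - G s) - (G (\<tau> x s) - G s)\<^sup>2 / b
        \<le> Gauss_isoperimetric (G (\<tau> x s)) - Gauss_isoperimetric (G s)" for x
      using Gauss_isoperimetric_quadratic_lower[of "G (\<tau> x s)" "G s"] unit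
      by (simp add: J_def b_def)
  qed
  finally have "h * (- J * \<Delta> - g / b) \<le> w - b"
    using h mult_left_mono[OF _ h(1)] unfolding w_def step_eq[OF I] b_def by auto
  moreover have "Gauss_isoperimetric q \<le> b - J * (h * \<Delta>)"
    using Gauss_isoperimetric_tangent[OF q_unit unit[of s]] q by (simp add: b_def J_def)
  ultimately have qw: "Gauss_isoperimetric q \<le> w + h * (g / b)"
    by (simp add: algebra_simps)
  have w0: "0 \<le> w"
    unfolding w_def by (rule step_bounds(1)[OF I, of 0 1])
      (use h Gauss_isoperimetric_nonneg Gauss_isoperimetric_le_1 in auto)
  have wb: "w \<le> b + h * mass"
  proof -
    have "jump_int (\<lambda>s. Gauss_isoperimetric (G s)) s \<le> 1 * mass"
      unfolding jump_int_def
      by (rule integral_bounds(2)[OF integrable_jump[OF I], of 0])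
        (auto simp: Gauss_isoperimetric_nonneg Gauss_isoperimetric_le_1)
    then have "w \<le> (1 - h * mass) * b + h * mass"
      unfolding w_def step_def b_def using mult_left_mono[OF _ h(1)] by auto
    also have "\<dots> \<le> b + h * mass"
      using b h by (simp add: algebra_simps)
    finally show ?thesis .
  qed
  have gb: "0 \<le> g / b" "g / b \<le> mass / c"
    using g b c by (auto intro!: frac_le)
  have "(Gauss_isoperimetric q)\<^sup>2 \<le> (w + h * (g / b))\<^sup>2"
    using qw Gauss_isoperimetric_nonneg by (intro power_mono)
  also have "\<dots> = w\<^sup>2 + 2 * h * (g / b) * w + h\<^sup>2 * (g / b)\<^sup>2"
    by (simp add: power2_eq_square algebra_simps)
  also have "\<dots> \<le> w\<^sup>2 + 2 * h * (g / b) * (b + h * mass) + h\<^sup>2 * (mass / c)\<^sup>2"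
  proof -
    have "2 * h * (g / b) * w \<le> 2 * h * (g / b) * (b + h * mass)"
      by (rule mult_left_mono[OF wb]) (intro mult_nonneg_nonneg h gb, simp)
    moreover have "h\<^sup>2 * (g / b)\<^sup>2 \<le> h\<^sup>2 * (mass / c)\<^sup>2"
      by (intro mult_left_mono power_mono gb) auto
    ultimately show ?thesis by linarith
  qed
  also have "2 * h * (g / b) * (b + h * mass) = 2 * h * g + h\<^sup>2 * (2 * (g / b) * mass)"
    using b by (simp add: field_simps power2_eq_square)
  also have "h\<^sup>2 * (2 * (g / b) * mass) \<le> h\<^sup>2 * (2 * (mass / c) * mass)"
    using gb by (intro mult_left_mono mult_right_mono) auto
  finally have 1: "(Gauss_isoperimetric q)\<^sup>2
      \<le> w\<^sup>2 + (2 * h * g + h\<^sup>2 * (2 * (mass / c) * mass)) + h\<^sup>2 * (mass / c)\<^sup>2"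
    by simp
  \<comment> \<open>For each x the gradient after the step is
    \<open>D s + h (jump_int D s - mass * D s)\<close>. Since \<open>\<bar>D\<bar> \<le> 1\<close>,
    the bracket is at most \<open>2 * mass\<close> in absolute value, so the mixed term of the
    square costs at most \<open>4 * h * mass\<close>; integration over x supplies the second factor
    \<open>mass\<close>.\<close>
  have 2: "g - 4 * h * mass\<^sup>2 \<le> sq_grad (step h G) s"
  proof -
    have "g - (4 * h * mass) * mass = (\<integral>x. (G (\<tau> x s) - G s)\<^sup>2 - 4 * h * mass \<partial>\<sigma>)"
      unfolding g_def sq_grad_def using int2 by (simp add: mass_def mult.commute)
    also have "\<dots> \<le> sq_grad (step h G) s"
      unfolding sq_grad_def
    proof (rule integral_mono)
      fix x
      define D where "D r = G (\<tau> x r) - G r" for r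
      have D: "bdd_meas D"
        unfolding D_def[abs_def]
        using bdd_meas_lincomb[OF bdd_meas_jump[OF G(1)] G(1), of 1 x "-1"] by simp
      have "\<bar>D r\<bar> \<le> 1" for r using diff by (simp add: D_def)
      note D1 = this
      have eq: "step h G (\<tau> x s) - step h G s = D s + h * (jump_int D s - mass * D s)"
        using step_diff_jump[OF G(1), of h x s] unfolding D_def[symmetric]
        by (simp add: step_def algebra_simps)
      have "\<bar>jump_int D s\<bar> \<le> mass" using abs_jump_int_le[OF D D1, of s] by simp
      moreover have "\<bar>mass * D s\<bar> \<le> mass * 1"
        unfolding abs_mult using D1 by (intro mult_mono) auto
      ultimately have "\<bar>jump_int D s - mass * D s\<bar> \<le> 2 * mass" by linarith
      then have "\<bar>D s * (jump_int D s - mass * D s)\<bar> \<le> 1 * (2 * mass)"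
        unfolding abs_mult using D1 by (intro mult_mono) auto
      then have "- (2 * mass) \<le> D s * (jump_int D s - mass * D s)" by linarith
      then have "(2 * h) * (- (2 * mass)) \<le> (2 * h) * (D s * (jump_int D s - mass * D s))"
        using h by (intro mult_left_mono) auto
      then have "(D s)\<^sup>2 - 4 * h * mass \<le> (D s)\<^sup>2 + 2 * h * (D s * (jump_int D s - mass * D s))"
        by simp
      also have "\<dots> \<le> (D s + h * (jump_int D s - mass * D s))\<^sup>2"
        unfolding power2_sum by (simp add: algebra_simps)
      finally show "(G (\<tau> x s) - G s)\<^sup>2 - 4 * h * mass \<le> (step h G (\<tau> x s) - step h G s)\<^sup>2"
        unfolding eq by (simp add: D_def)
    qed (use int2 integrable_sq_grad[OF bdd_meas_step[OF G(1)]] in auto)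
    finally show ?thesis by (simp add: power2_eq_square mult_ac)
  qed
  have "2 * h * g \<le> 2 * h * (sq_grad (step h G) s + 4 * h * mass\<^sup>2)"
    using 2 h by (intro mult_left_mono) auto
  also have "\<dots> = 2 * h * sq_grad (step h G) s + 8 * mass\<^sup>2 * h\<^sup>2"
    by (simp add: algebra_simps power2_eq_square)
  finally show ?thesis
    using 1 unfolding q_def[symmetric] w_def[symmetric]
    by (simp add: algebra_simps power_divide power2_eq_square)
qed

text \<open>
  The iteration trades carre du champ weight \<open>t\<close> for steps of the chain; each step costs an error
  of second order in \<open>h\<close>.
\<close>

lemma steps_Bobkov:
  assumes F: "bdd_meas F" "\<And>s. e \<le> F s" "\<And>s. F s \<le> 1 - e" and e: "0 < e"
    and c: "0 < c" "\<And>t. e \<le> t \<Longrightarrow> t \<le> 1 - e \<Longrightarrow> c \<le> Gauss_isoperimetric t"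
    and h: "0 \<le> h" "h * mass \<le> 1" and t: "0 \<le> t"
    and C: "C = 8 * mass\<^sup>2 + 2 * mass\<^sup>2 / c + mass\<^sup>2 / c\<^sup>2"
  shows "sqrt ((Gauss_isoperimetric ((step h ^^ n) F s))\<^sup>2 + 2 * t * sq_grad ((step h ^^ n) F) s)
    \<le> (step h ^^ n) (\<lambda>s. sqrt ((Gauss_isoperimetric (F s))\<^sup>2 + 2 * (t + n * h) * sq_grad F s)) s
      + n * (C * h\<^sup>2 / c)"
  using F
proof (induction n arbitrary: F s)
  case (Suc n)
  define k where "k = C * h\<^sup>2 / c"
  define t' where "t' = t + real n * h"
  have t': "0 \<le> t'" using t h by (simp add: t'_def)
  have Ck: "0 \<le> C * h\<^sup>2" unfolding C using c by (intro mult_nonneg_nonneg add_nonneg_nonneg) auto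
  define G where "G = step h F"
  define P where "P s = step h (\<lambda>s. Gauss_isoperimetric (F s)) s" for s
  define V where "V s = sqrt ((Gauss_isoperimetric (F s))\<^sup>2 + 2 * (t' + h) * sq_grad F s)" for s
  define U where "U s = sqrt ((Gauss_isoperimetric (G s))\<^sup>2 + 2 * t' * sq_grad G s)" for s
  have G: "bdd_meas G" "\<And>s. e \<le> G s" "\<And>s. G s \<le> 1 - e"
    unfolding G_def using bdd_meas_step[OF Suc.prems(1)] step_bounds[OF Suc.prems h] by auto
  have IF: "bdd_meas (\<lambda>s. Gauss_isoperimetric (F s))"
    by (rule bdd_meas_Gauss_isoperimetric[OF Suc.prems(1)])
  have bddV: "bdd_meas V"
    unfolding V_def[abs_def] using t' h by (intro bdd_meas_sqrt IF Suc.prems) auto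
  have bddU: "bdd_meas U"
    unfolding U_def[abs_def] using t' by (intro bdd_meas_sqrt bdd_meas_Gauss_isoperimetric G) auto
  have UV: "U s \<le> step h V s + k" for s
  proof -
    define W where "W = sqrt ((P s)\<^sup>2 + 2 * (t' + h) * sq_grad G s)"
    have "W \<le> step h V s"
      unfolding W_def P_def G_def V_def using t' h c(2) Suc.prems
      by (intro step_Minkowski[OF IF c(1)]) auto
    moreover have "U s \<le> W + k"
    proof -
      have U2: "(U s)\<^sup>2 = (Gauss_isoperimetric (G s))\<^sup>2 + 2 * t' * sq_grad G s"
        unfolding U_def using t' sq_grad_nonneg by simp
      have W2: "W\<^sup>2 = (P s)\<^sup>2 + 2 * (t' + h) * sq_grad G s"
        unfolding W_def using t' h sq_grad_nonneg by simp
      have W0: "0 \<le> W" unfolding W_def using t' h sq_grad_nonneg by simp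
      have "(U s)\<^sup>2 \<le> W\<^sup>2 + C * h\<^sup>2"
        using step_Gauss_isoperimetric[OF Suc.prems e c h, of s]
        unfolding U2 W2 C[symmetric] G_def P_def by (simp add: algebra_simps)
      \<comment> \<open>The passage from squares to roots: \<open>U s + W\<close> is at least
        \<open>c\<close>, because \<open>U s\<close> dominates the isoperimetric function of a value
        in \<open>[e, 1 - e]\<close>.\<close>
      then have "(U s - W) * (U s + W) \<le> C * h\<^sup>2"
        by (simp add: power2_eq_square algebra_simps)
      moreover have "c \<le> U s + W"
      proof -
        have "c \<le> Gauss_isoperimetric (G s)" using c(2) G by auto
        also have "\<dots> \<le> U s"
          unfolding U_def using t' sq_grad_nonneg by (intro real_le_rsqrt) auto
        finally show ?thesis using W0 by linarith
      qed
      ultimately have "U s - W \<le> k" if "0 < U s - W"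
      proof -
        have "(U s - W) * c \<le> (U s - W) * (U s + W)"
          using \<open>c \<le> U s + W\<close> that by (intro mult_left_mono) auto
        then have "(U s - W) * c \<le> C * h\<^sup>2"
          using \<open>(U s - W) * (U s + W) \<le> C * h\<^sup>2\<close> by linarith
        then show ?thesis
          unfolding k_def using c(1) by (simp add: pos_le_divide_eq)
      qed
      moreover have "0 \<le> k" unfolding k_def using Ck c(1) by simp
      ultimately show ?thesis by linarith
    qed
    ultimately show ?thesis by linarith
  qed
  \<comment> \<open>The hypothesis is applied to \<open>G = step h F\<close>, not to
    \<open>F\<close>: the innermost step is peeled off, and the weight \<open>t + n h\<close> at
    \<open>G\<close> turns into \<open>t + (n + 1) h\<close> at \<open>F\<close>.\<close>
  have "sqrt ((Gauss_isoperimetric ((step h ^^ n) G s))\<^sup>2 + 2 * t * sq_grad ((step h ^^ n) G) s)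
      \<le> (step h ^^ n) U s + n * k"
    unfolding U_def t'_def k_def by (rule Suc.IH[OF G])
  also have "(step h ^^ n) U s \<le> (step h ^^ n) (\<lambda>s. step h V s + k) s"
    using UV bdd_meas_lincomb[OF bdd_meas_step[OF bddV] bdd_meas_const[of 1], of 1 h k]
    by (intro steps_mono bddU h) auto
  also have "\<dots> = (step h ^^ n) (step h V) s + k"
    by (subst steps_add_const[OF bdd_meas_step[OF bddV]]) simp
  finally have "sqrt ((Gauss_isoperimetric ((step h ^^ n) G s))\<^sup>2 + 2 * t * sq_grad ((step h ^^ n) G) s)
      \<le> (step h ^^ n) (step h V) s + real (Suc n) * k"
    by (simp add: distrib_right)
  moreover have "V = (\<lambda>s. sqrt ((Gauss_isoperimetric (F s))\<^sup>2 + 2 * (t + real (Suc n) * h) * sq_grad F s))"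
    unfolding V_def[abs_def] t'_def by (simp add: distrib_right add_ac)
  ultimately show ?case
    unfolding funpow_Suc_right o_apply G_def[symmetric] k_def by simp
qed simp

text \<open>The operator \<open>exp L\<close> at time one, expanded as \<open>exp (- mass)\<close>
  times the exponential series of \<open>jump_int\<close>. Probabilistically, a Poisson number of
  points with mean \<open>mass\<close> is added to \<open>s\<close>.\<close>

definition jump_law :: "'s \<Rightarrow> ('s \<Rightarrow> real) \<Rightarrow> real" where
  "jump_law s H = (\<Sum>k. exp (- mass) / fact k * (jump_int ^^ k) H s)"

lemma jump_int_sum:
  assumes "\<And>k. k \<in> A \<Longrightarrow> bdd_meas (f k)"
  shows "jump_int (\<lambda>s. \<Sum>k\<in>A. c k * f k s) s = (\<Sum>k\<in>A. c k * jump_int (f k) s)"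
  using assms unfolding jump_int_def by (subst Bochner_Integration.integral_sum) auto

text \<open>The binomial theorem for the multiplication by \<open>1 - h * mass\<close> and the
  operator \<open>h * jump_int\<close>, which commute; Pascal's rule in
  \<open>binomial_sum_Suc\<close> is its induction step.\<close>

lemma steps_binomial:
  assumes "bdd_meas H"
  shows "(step h ^^ n) H s
    = (\<Sum>k\<le>n. real (n choose k) * (1 - h * mass) ^ (n - k) * h ^ k * (jump_int ^^ k) H s)"
proof (induction n arbitrary: s)
  case (Suc n)
  have eq: "(step h ^^ n) H
      = (\<lambda>s. \<Sum>k\<le>n. (real (n choose k) * (1 - h * mass) ^ (n - k) * h ^ k) * (jump_int ^^ k) H s)"
    by (rule ext) (rule Suc)
  have "jump_int ((step h ^^ n) H) s
      = (\<Sum>k\<le>n. (real (n choose k) * (1 - h * mass) ^ (n - k) * h ^ k) * (jump_int ^^ Suc k) H s)"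
    unfolding eq by (subst jump_int_sum) (auto intro: bdd_meas_jump_ints assms)
  moreover have "(step h ^^ Suc n) H s
      = (1 - h * mass) * (step h ^^ n) H s + h * jump_int ((step h ^^ n) H) s"
    by (simp add: step_def[of h "(step h ^^ n) H" s])
  ultimately show ?case
    unfolding binomial_sum_Suc Suc by (simp only:)
qed simp

lemma steps_tendsto_jump_law:
  assumes "bdd_meas H"
  shows "(\<lambda>n. (step (1 / real n) ^^ n) H s) \<longlonglongrightarrow> jump_law s H"
proof -
  obtain K where "\<And>s. \<bar>H s\<bar> \<le> K" using bdd_meas_bound[OF assms] by metis
  then show ?thesis
    unfolding steps_binomial[OF assms] jump_law_def
    by (intro tendsto_binomial_average[where K = K] abs_jump_ints_le assms) auto
qed

lemma jump_law_Bobkov_inner: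
  assumes F: "bdd_meas F" "\<And>s. e \<le> F s" "\<And>s. F s \<le> 1 - e" and e: "0 < e" "e < 1"
  shows "Gauss_isoperimetric (jump_law s F)
    \<le> jump_law s (\<lambda>s. sqrt ((Gauss_isoperimetric (F s))\<^sup>2 + 2 * sq_grad F s))"
proof -
  obtain c where c: "0 < c" "\<And>t. e \<le> t \<Longrightarrow> t \<le> 1 - e \<Longrightarrow> c \<le> Gauss_isoperimetric t"
    using Gauss_isoperimetric_lower_bound[OF e] by metis
  define C where "C = 8 * mass\<^sup>2 + 2 * mass\<^sup>2 / c + mass\<^sup>2 / c\<^sup>2"
  define R where "R = (\<lambda>s. sqrt ((Gauss_isoperimetric (F s))\<^sup>2 + 2 * sq_grad F s))"
  have R: "bdd_meas R"
    unfolding R_def by (intro bdd_meas_sqrt bdd_meas_Gauss_isoperimetric F) auto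
  have "(\<lambda>n. Gauss_isoperimetric ((step (1 / real n) ^^ n) F s)) \<longlonglongrightarrow> Gauss_isoperimetric (jump_law s F)"
    by (rule isCont_tendsto_compose[OF isCont_Gauss_isoperimetric steps_tendsto_jump_law[OF F(1)]])
  moreover have "(\<lambda>n. (step (1 / real n) ^^ n) R s + C / c / real n) \<longlonglongrightarrow> jump_law s R + 0"
    by (intro tendsto_add steps_tendsto_jump_law R lim_const_over_n)
  moreover have "eventually (\<lambda>n. Gauss_isoperimetric ((step (1 / real n) ^^ n) F s)
      \<le> (step (1 / real n) ^^ n) R s + C / c / real n) sequentially"
    using eventually_gt_at_top[of "nat \<lceil>mass\<rceil>"]
  proof eventually_elim
    case (elim n)
    then have n: "mass < real n" by linarith
    then have n0: "0 < real n" using mass_nonneg by linarith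
    \<comment> \<open>Weight 0 on the left deletes the gradient of the averaged function, and
      \<open>n\<close> steps of size \<open>1 / n\<close> bring the weight on the right to exactly
      1.\<close>
    have "sqrt ((Gauss_isoperimetric ((step (1 / real n) ^^ n) F s))\<^sup>2
          + 2 * 0 * sq_grad ((step (1 / real n) ^^ n) F) s)
        \<le> (step (1 / real n) ^^ n) (\<lambda>s. sqrt ((Gauss_isoperimetric (F s))\<^sup>2
          + 2 * (0 + real n * (1 / real n)) * sq_grad F s)) s + real n * (C * (1 / real n)\<^sup>2 / c)"
      using n n0 by (intro steps_Bobkov[OF F e(1) c _ _ _ C_def]) auto
    then show ?case
      using n0 Gauss_isoperimetric_nonneg by (simp add: R_def power2_eq_square mult.commute)
  qed
  ultimately show ?thesis
    unfolding R_def[symmetric] by (intro tendsto_le[OF sequentially_bot]) auto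
qed

end

section \<open>The law of the growth process\<close>

context commuting_jumps
begin

text \<open>The law of the state after \<open>k\<close> added points, left unnormalised: its total
  mass is \<open>mass ^ k\<close>, the factor that the Poisson weight of \<open>k\<close> points
  still lacks.\<close>

primrec jump_kernel :: "'s \<Rightarrow> nat \<Rightarrow> 's measure" where
  "jump_kernel s 0 = return S s"
| "jump_kernel s (Suc k) = distr (\<sigma> \<Otimes>\<^sub>M jump_kernel s k) S (case_prod \<tau>)"

lemma sets_jump_kernel [simp, measurable_cong]: "sets (jump_kernel s k) = sets S"
  by (cases k) auto

lemma space_jump_kernel [simp]: "space (jump_kernel s k) = UNIV"
  using sets_eq_imp_space_eq[OF sets_jump_kernel] by simp

lemma finite_jump_kernel: "finite_measure (jump_kernel s k)"
proof (induction k)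
  case 0
  then show ?case using prob_space_return[of s S] by (simp add: prob_space_def)
next
  case (Suc k)
  interpret K: finite_measure "jump_kernel s k" by (rule Suc)
  interpret P: finite_measure "\<sigma> \<Otimes>\<^sub>M jump_kernel s k"
    by (rule finite_measure_pair_measure) (rule finite_measure_axioms Suc)+
  have "case_prod \<tau> \<in> \<sigma> \<Otimes>\<^sub>M jump_kernel s k \<rightarrow>\<^sub>M S"
    using measurable_jump by (simp cong: measurable_cong_sets)
  then show ?case by (simp add: P.finite_measure_distr)
qed

lemma nn_integral_jump_kernel:
  assumes "bdd_meas H" "\<And>s. 0 \<le> H s"
  shows "(\<integral>\<^sup>+s. ennreal (H s) \<partial>jump_kernel s0 k) = ennreal ((jump_int ^^ k) H s0)"
  using assms
proof (induction k arbitrary: H)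
  case 0
  note 0(1)[THEN bdd_measD, measurable]
  show ?case by (simp add: nn_integral_return)
next
  case (Suc k)
  note Suc.prems(1)[THEN bdd_measD, measurable]
  interpret K: finite_measure "jump_kernel s0 k" by (rule finite_jump_kernel)
  interpret P: pair_sigma_finite \<sigma> "jump_kernel s0 k"
    by (simp add: pair_sigma_finite_def sigma_finite_measure_axioms K.sigma_finite_measure_axioms)
  have jump [measurable]: "case_prod \<tau> \<in> \<sigma> \<Otimes>\<^sub>M jump_kernel s0 k \<rightarrow>\<^sub>M S"
    using measurable_jump by (simp cong: measurable_cong_sets)
  have "(\<integral>\<^sup>+s. ennreal (H s) \<partial>jump_kernel s0 (Suc k))
      = (\<integral>\<^sup>+p. ennreal (H (case_prod \<tau> p)) \<partial>(\<sigma> \<Otimes>\<^sub>M jump_kernel s0 k))"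
    unfolding jump_kernel.simps by (rule nn_integral_distr[OF jump]) measurable
  also have "\<dots> = (\<integral>\<^sup>+s. (\<integral>\<^sup>+x. ennreal (H (\<tau> x s)) \<partial>\<sigma>) \<partial>jump_kernel s0 k)"
    by (subst P.nn_integral_snd[symmetric]) (auto simp: split_beta)
  also have "\<dots> = (\<integral>\<^sup>+s. ennreal (jump_int H s) \<partial>jump_kernel s0 k)"
    unfolding jump_int_def using Suc.prems
    by (intro nn_integral_cong nn_integral_eq_integral) auto
  also have "\<dots> = ennreal ((jump_int ^^ k) (jump_int H) s0)"
    using Suc.prems by (intro Suc.IH bdd_meas_jump_int) (auto simp: jump_int_def intro!: integral_nonneg_AE)
  finally show ?case by (simp add: funpow_swap1)
qed

text \<open>A genuine measure behind the functional \<open>jump_law\<close>. With it the law of the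
  counts can be identified from generating functions alone, and the identity of measures then covers
  all bounded measurable functions.\<close>

definition jump_law_measure :: "'s \<Rightarrow> 's measure" where
  "jump_law_measure s0 = measure_of UNIV (sets S)
     (\<lambda>E. \<Sum>k. ennreal (exp (- mass) / fact k) * emeasure (jump_kernel s0 k) E)"

lemma sets_jump_law_measure [simp, measurable_cong]: "sets (jump_law_measure s0) = sets S"
proof -
  have "sets S \<subseteq> Pow UNIV" by simp
  then show ?thesis
    unfolding jump_law_measure_def using sets.sigma_sets_eq[of S] by simp
qed

lemma emeasure_jump_law_measure:
  assumes "E \<in> sets S"
  shows "emeasure (jump_law_measure s0) E
    = (\<Sum>k. ennreal (exp (- mass) / fact k) * emeasure (jump_kernel s0 k) E)"
  unfolding jump_law_measure_def
proof (subst emeasure_measure_of_sigma)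
  show "sigma_algebra UNIV (sets S)"
    using sets.sigma_algebra_axioms[of S] by simp
  show "positive (sets S) (\<lambda>E. \<Sum>k. ennreal (exp (- mass) / fact k) * emeasure (jump_kernel s0 k) E)"
    by (simp add: positive_def)
  show "countably_additive (sets S) (\<lambda>E. \<Sum>k. ennreal (exp (- mass) / fact k) * emeasure (jump_kernel s0 k) E)"
  proof (rule countably_additiveI)
    fix A :: "nat \<Rightarrow> 's set"
    assume A: "range A \<subseteq> sets S" "disjoint_family A"
    \<comment> \<open>Two series of nonnegative terms are exchanged by reading one of them as an
      integral over the counting measure.\<close>
    have "(\<Sum>i. \<Sum>k. ennreal (exp (- mass) / fact k) * emeasure (jump_kernel s0 k) (A i))
        = (\<Sum>k. \<Sum>i. ennreal (exp (- mass) / fact k) * emeasure (jump_kernel s0 k) (A i))"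
      using nn_integral_suminf[of "\<lambda>i k. ennreal (exp (- mass) / fact k) * emeasure (jump_kernel s0 k) (A i)"
          "count_space UNIV"]
      by (simp only: nn_integral_count_space_nat measurable_count_space_eq1 space_borel Pi_UNIV UNIV_I)
    also have "\<dots> = (\<Sum>k. ennreal (exp (- mass) / fact k) * emeasure (jump_kernel s0 k) (\<Union> (range A)))"
      using A by (simp add: suminf_emeasure)
    finally show "(\<Sum>i. \<Sum>k. ennreal (exp (- mass) / fact k) * emeasure (jump_kernel s0 k) (A i))
        = (\<Sum>k. ennreal (exp (- mass) / fact k) * emeasure (jump_kernel s0 k) (\<Union> (range A)))" .
  qed
qed (use assms in simp_all)

lemma nn_integral_jump_law_measure:
  assumes "f \<in> borel_measurable S"
  shows "(\<integral>\<^sup>+s. f s \<partial>jump_law_measure s0)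
    = (\<Sum>k. ennreal (exp (- mass) / fact k) * (\<integral>\<^sup>+s. f s \<partial>jump_kernel s0 k))"
  using assms
proof (induction rule: borel_measurable_induct)
  case (cong f g)
  then have "f = g" by (auto simp: fun_eq_iff)
  with cong show ?case by simp
next
  case (set A)
  then show ?case by (simp add: emeasure_jump_law_measure)
next
  case (mult u c)
  then show ?case
    by (simp add: nn_integral_cmult mult.left_commute)
next
  case (add u v)
  then show ?case
    by (simp add: nn_integral_add distrib_left suminf_add[symmetric])
next
  case (seq U)
  then have U [measurable]: "\<And>i. U i \<in> borel_measurable S" by auto
  have SUP_eq: "(SUP i. U i) = (\<lambda>s. SUP i. U i s)"
    by (rule ext) (simp add: image_comp)
  have "(\<integral>\<^sup>+s. (SUP i. U i) s \<partial>jump_law_measure s0) = (SUP i. \<integral>\<^sup>+s. U i s \<partial>jump_law_measure s0)"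
    using seq unfolding SUP_eq by (subst nn_integral_monotone_convergence_SUP) auto
  also have "\<dots> = (SUP i. \<Sum>k. ennreal (exp (- mass) / fact k) * (\<integral>\<^sup>+s. U i s \<partial>jump_kernel s0 k))"
    using seq by simp
  also have "\<dots> = (\<Sum>k. SUP i. ennreal (exp (- mass) / fact k) * (\<integral>\<^sup>+s. U i s \<partial>jump_kernel s0 k))"
    using seq by (intro ennreal_suminf_SUP_eq[symmetric])
      (auto simp: incseq_def le_fun_def intro!: mult_left_mono nn_integral_mono)
  also have "\<dots> = (\<Sum>k. ennreal (exp (- mass) / fact k) * (SUP i. \<integral>\<^sup>+s. U i s \<partial>jump_kernel s0 k))"
    by (simp add: SUP_mult_left_ennreal)
  also have "\<dots> = (\<Sum>k. ennreal (exp (- mass) / fact k) * (\<integral>\<^sup>+s. (SUP i. U i) s \<partial>jump_kernel s0 k))"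
    using seq unfolding SUP_eq by (subst nn_integral_monotone_convergence_SUP) auto
  finally show ?case .
qed

lemma nn_integral_jump_law_measure_bdd:
  assumes "bdd_meas H" "\<And>s. 0 \<le> H s"
  shows "0 \<le> jump_law s0 H"
    and "(\<integral>\<^sup>+s. ennreal (H s) \<partial>jump_law_measure s0) = ennreal (jump_law s0 H)"
proof -
  note assms(1)[THEN bdd_measD, measurable]
  obtain K where K: "\<And>s. \<bar>H s\<bar> \<le> K" using bdd_meas_bound[OF assms(1)] by metis
  have nn: "0 \<le> (jump_int ^^ k) H s" for k s
    by (induction k arbitrary: s) (auto simp: assms(2) jump_int_def intro!: integral_nonneg_AE)
  have summable: "summable (\<lambda>k. exp (- mass) / fact k * (jump_int ^^ k) H s0)"
  proof (rule summable_comparison_test')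
    show "summable (\<lambda>k. exp (- mass) * K * (mass ^ k / fact k))"
      using summable_exp[of mass] by (intro summable_mult) (simp add: field_simps)
    show "norm (exp (- mass) / fact k * (jump_int ^^ k) H s0) \<le> exp (- mass) * K * (mass ^ k / fact k)" for k
      using abs_jump_ints_le[OF assms(1) K, of k s0] by (simp add: abs_mult field_simps)
  qed
  then have "(\<Sum>k. ennreal (exp (- mass) / fact k * (jump_int ^^ k) H s0)) = ennreal (jump_law s0 H)"
    unfolding jump_law_def using nn by (intro suminf_ennreal2) auto
  moreover have "(\<integral>\<^sup>+s. ennreal (H s) \<partial>jump_law_measure s0)
      = (\<Sum>k. ennreal (exp (- mass) / fact k * (jump_int ^^ k) H s0))"
    by (subst nn_integral_jump_law_measure, measurable)
      (simp only: nn_integral_jump_kernel[OF assms] ennreal_mult''[OF nn])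
  ultimately show "(\<integral>\<^sup>+s. ennreal (H s) \<partial>jump_law_measure s0) = ennreal (jump_law s0 H)"
    by simp
  show "0 \<le> jump_law s0 H"
    unfolding jump_law_def using nn summable by (intro suminf_nonneg) auto
qed

lemma integral_jump_law_measure:
  assumes "bdd_meas H" "\<And>s. 0 \<le> H s"
  shows "(\<integral>s. H s \<partial>jump_law_measure s0) = jump_law s0 H"
proof -
  note assms(1)[THEN bdd_measD, measurable]
  show ?thesis
    using assms(2) nn_integral_jump_law_measure_bdd[OF assms, of s0]
    by (subst integral_eq_nn_integral) auto
qed

lemma finite_jump_law_measure: "finite_measure (jump_law_measure s0)"
proof (rule finite_measureI)
  have "(\<integral>\<^sup>+s. ennreal 1 \<partial>jump_law_measure s0) = ennreal (jump_law s0 (\<lambda>_. 1))"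
    by (intro nn_integral_jump_law_measure_bdd bdd_meas_const) auto
  then show "emeasure (jump_law_measure s0) (space (jump_law_measure s0)) \<noteq> \<infinity>" by simp
qed

lemma Bobkov_jump_law:
  assumes N: "prob_space N" "sets N = sets S"
    and law: "\<And>H. bdd_meas H \<Longrightarrow> (\<And>s. 0 \<le> H s) \<Longrightarrow> (\<integral>s. H s \<partial>N) = jump_law s0 H"
    and F: "F \<in> borel_measurable S" "\<And>s. 0 \<le> F s" "\<And>s. F s \<le> 1"
  shows "Gauss_isoperimetric (\<integral>s. F s \<partial>N)
    \<le> (\<integral>s. sqrt ((Gauss_isoperimetric (F s))\<^sup>2 + 2 * sq_grad F s) \<partial>N)"
proof -
  interpret N: prob_space N by (rule N)
  have [measurable_cong]: "sets N = sets S" by (rule N)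
  note F(1)[measurable]
  have bddF: "bdd_meas F" using F by (intro bdd_measI[of _ 1]) auto
  note bdd_meas_sq_grad[OF bddF, THEN bdd_measD, measurable]
  \<comment> \<open>The shift by 3 keeps \<open>e n\<close> at most 1/3, so that the factor
    \<open>1 - 2 * e n\<close> is positive and below 1.\<close>
  define e where "e n = 1 / (real n + 3)" for n
  have e: "0 < e n" "e n \<le> 1 / 3" for n unfolding e_def by auto
  have e0: "e \<longlonglongrightarrow> 0" unfolding e_def[abs_def] by real_asymp
  define Fn where "Fn n s = (1 - 2 * e n) * F s + e n * 1" for n s
  have bddFn: "bdd_meas (Fn n)" for n
    unfolding Fn_def[abs_def] by (intro bdd_meas_lincomb bddF bdd_meas_const)
  note bddFn[THEN bdd_measD, measurable]
  have Fn: "e n \<le> Fn n s" "Fn n s \<le> 1 - e n" for n s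
  proof -
    have "0 \<le> (1 - 2 * e n) * F s" "(1 - 2 * e n) * F s \<le> (1 - 2 * e n) * 1"
      using e[of n] F by (auto intro!: mult_nonneg_nonneg mult_left_mono simp del: mult_1_right)
    then show "e n \<le> Fn n s" "Fn n s \<le> 1 - e n" unfolding Fn_def by auto
  qed
  have Fn_lim: "(\<lambda>n. Fn n s) \<longlonglongrightarrow> F s" for s
  proof -
    have "(\<lambda>n. (1 - 2 * e n) * F s + e n * 1) \<longlonglongrightarrow> (1 - 2 * 0) * F s + 0 * 1"
      by (intro tendsto_intros e0)
    then show ?thesis by (simp add: Fn_def)
  qed
  have bound: "norm (sqrt ((Gauss_isoperimetric t)\<^sup>2 + 2 * sq_grad F s)) \<le> sqrt (1 + 2 * mass)" for t s
  proof -
    have "\<bar>F s - F s'\<bar> \<le> 1" for s s'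
      using F(2,3)[of s] F(2,3)[of s'] by (auto simp: abs_le_iff)
    then have "sq_grad F s \<le> mass" using sq_grad_le[OF bddF, of 1 s] by simp
    moreover have "(Gauss_isoperimetric t)\<^sup>2 \<le> 1"
      using Gauss_isoperimetric_nonneg Gauss_isoperimetric_le_1 by (simp add: power_le_one)
    ultimately show ?thesis using sq_grad_nonneg[of F s] by simp
  qed
  have grad: "sq_grad (Fn n) s \<le> sq_grad F s" for n s
  proof -
    have "(Fn n r - Fn n s)\<^sup>2 \<le> (F r - F s)\<^sup>2" for r
    proof -
      have "Fn n r - Fn n s = (1 - 2 * e n) * (F r - F s)" by (simp add: Fn_def algebra_simps)
      then have "\<bar>Fn n r - Fn n s\<bar> = \<bar>1 - 2 * e n\<bar> * \<bar>F r - F s\<bar>" by (simp add: abs_mult)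
      also have "\<dots> \<le> 1 * \<bar>F r - F s\<bar>" using e[of n] by (intro mult_right_mono) auto
      finally show ?thesis by (simp add: abs_le_square_iff)
    qed
    then show ?thesis
      unfolding sq_grad_def by (intro integral_mono integrable_sq_grad bddF bddFn)
  qed
  \<comment> \<open>The gradient of \<open>F\<close> already replaces that of \<open>Fn n\<close> on
    the right. Under the integral only the isoperimetric term still varies with \<open>n\<close>,
    and it does so continuously and boundedly.\<close>
  have le: "Gauss_isoperimetric (\<integral>s. Fn n s \<partial>N)
      \<le> (\<integral>s. sqrt ((Gauss_isoperimetric (Fn n s))\<^sup>2 + 2 * sq_grad F s) \<partial>N)" for n
  proof -
    have R: "bdd_meas (\<lambda>s. sqrt ((Gauss_isoperimetric (Fn n s))\<^sup>2 + 2 * sq_grad (Fn n) s))"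
      by (intro bdd_meas_sqrt bdd_meas_Gauss_isoperimetric bddFn) auto
    note R[THEN bdd_measD, measurable]
    obtain K where K: "\<And>s. \<bar>sqrt ((Gauss_isoperimetric (Fn n s))\<^sup>2 + 2 * sq_grad (Fn n) s)\<bar> \<le> K"
      using bdd_meas_bound[OF R] by metis
    have "0 \<le> Fn n s" for s using Fn(1)[of n s] e(1)[of n] by linarith
    then have "Gauss_isoperimetric (\<integral>s. Fn n s \<partial>N)
        \<le> (\<integral>s. sqrt ((Gauss_isoperimetric (Fn n s))\<^sup>2 + 2 * sq_grad (Fn n) s) \<partial>N)"
      using jump_law_Bobkov_inner[OF bddFn Fn, of n s0] e[of n]
      by (subst (1 2) law) (auto simp: bddFn R sq_grad_nonneg)
    also have "\<dots> \<le> (\<integral>s. sqrt ((Gauss_isoperimetric (Fn n s))\<^sup>2 + 2 * sq_grad F s) \<partial>N)"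
    proof (rule integral_mono)
      show "integrable N (\<lambda>s. sqrt ((Gauss_isoperimetric (Fn n s))\<^sup>2 + 2 * sq_grad (Fn n) s))"
        using K by (intro N.integrable_const_bound[of _ K]) auto
      show "integrable N (\<lambda>s. sqrt ((Gauss_isoperimetric (Fn n s))\<^sup>2 + 2 * sq_grad F s))"
        using bound by (intro N.integrable_const_bound[of _ "sqrt (1 + 2 * mass)"]) auto
    qed (use grad in auto)
    finally show ?thesis .
  qed
  have "(\<lambda>n. \<integral>s. Fn n s \<partial>N) \<longlonglongrightarrow> (\<integral>s. F s \<partial>N)"
  proof (rule integral_dominated_convergence[where w = "\<lambda>_. 1"])
    show "AE s in N. norm (Fn n s) \<le> 1" for n
    proof (rule AE_I2)
      fix s show "norm (Fn n s) \<le> 1" using Fn[of n s] e[of n] by simp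
    qed
  qed (use Fn_lim in auto)
  then have "(\<lambda>n. Gauss_isoperimetric (\<integral>s. Fn n s \<partial>N)) \<longlonglongrightarrow> Gauss_isoperimetric (\<integral>s. F s \<partial>N)"
    by (rule isCont_tendsto_compose[OF isCont_Gauss_isoperimetric])
  moreover have "(\<lambda>n. \<integral>s. sqrt ((Gauss_isoperimetric (Fn n s))\<^sup>2 + 2 * sq_grad F s) \<partial>N)
      \<longlonglongrightarrow> (\<integral>s. sqrt ((Gauss_isoperimetric (F s))\<^sup>2 + 2 * sq_grad F s) \<partial>N)"
  proof (rule integral_dominated_convergence[where w = "\<lambda>_. sqrt (1 + 2 * mass)"])
    show "AE s in N. (\<lambda>n. sqrt ((Gauss_isoperimetric (Fn n s))\<^sup>2 + 2 * sq_grad F s))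
        \<longlonglongrightarrow> sqrt ((Gauss_isoperimetric (F s))\<^sup>2 + 2 * sq_grad F s)"
      by (intro AE_I2 tendsto_intros isCont_tendsto_compose[OF isCont_Gauss_isoperimetric] Fn_lim)
  qed (use bound in auto)
  ultimately show ?thesis
    using le by (intro tendsto_le[OF sequentially_bot]) auto
qed

end

section \<open>Generating functions\<close>

text \<open>Once the earlier coefficients vanish, dividing by \<open>z ^ n\<close> leaves
  \<open>d n\<close> plus a remainder of at most \<open>C z / (1 - z)\<close>, which tends to 0 with
  \<open>z\<close>. Values at small positive \<open>z\<close> are enough.\<close>

lemma power_series_unique:
  fixes d :: "nat \<Rightarrow> real"
  assumes bound: "\<And>n. \<bar>d n\<bar> \<le> C"
    and zero: "\<And>z. 0 < z \<Longrightarrow> z < 1 \<Longrightarrow> (\<lambda>n. d n * z ^ n) sums 0"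
  shows "d n = 0"
proof (induction n rule: less_induct)
  case (less n)
  have C: "0 \<le> C" using bound[of 0] by linarith
  have "\<bar>d n\<bar> \<le> 2 * C * z" if z: "0 < z" "z < 1 / 2" for z
  proof -
    have sums: "(\<lambda>i. d (i + n) * z ^ (i + n)) sums 0"
      using sums_split_initial_segment[OF zero, of z n] less z by simp
    then have "(\<lambda>i. d (i + n) * z ^ (i + n) / z ^ n) sums (0 / z ^ n)"
      by (rule sums_divide)
    moreover have "(\<lambda>i. d (i + n) * z ^ (i + n) / z ^ n) = (\<lambda>i. d (i + n) * z ^ i)"
      using z by (auto simp: power_add)
    ultimately have "(\<lambda>i. d (i + n) * z ^ i) sums 0" by simp
    then have s1: "(\<lambda>i. d (Suc i + n) * z ^ Suc i) sums (- d n)"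
      by (subst sums_Suc_iff) simp
    have s2: "(\<lambda>i. C * z * z ^ i) sums (C * z * (1 / (1 - z)))"
      using z by (intro sums_mult geometric_sums) auto
    have le: "norm (d (Suc i + n) * z ^ Suc i) \<le> C * z * z ^ i" for i
      using z bound[of "Suc i + n"] by (auto simp: abs_mult intro!: mult_right_mono)
    have "norm (- d n) \<le> C * z * (1 / (1 - z))"
      using norm_suminf_le[OF le sums_summable[OF s2]]
      unfolding sums_unique[OF s1, symmetric] sums_unique[OF s2, symmetric] .
    also have "\<dots> \<le> C * z * 2"
      using z C by (intro mult_left_mono) (auto simp: field_simps)
    finally show ?thesis by simp
  qed
  then have "eventually (\<lambda>z. \<bar>d n\<bar> \<le> 2 * C * z) (at_right 0)"
    by (auto simp: eventually_at_right_field intro!: exI[of _ "1 / 2"])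
  moreover have "((\<lambda>z. 2 * C * z) \<longlongrightarrow> 2 * C * 0) (at_right 0)"
    by (intro tendsto_intros)
  ultimately have "\<bar>d n\<bar> \<le> 2 * C * 0"
    by (intro tendsto_lowerbound[of "\<lambda>z. 2 * C * z" _ "at_right 0"]) auto
  then show ?case by simp
qed

text \<open>Splitting by the value of \<open>X\<close>, with truncation and dominated convergence.
  For \<open>f n = z ^ n\<close> it exhibits the integral as a power series in \<open>z\<close> with
  bounded coefficients.\<close>

lemma (in finite_measure) integral_nat_fun_sums:
  fixes W :: "'a \<Rightarrow> real" and f :: "nat \<Rightarrow> real"
  assumes [measurable]: "W \<in> borel_measurable M" "X \<in> M \<rightarrow>\<^sub>M count_space UNIV"
    and W: "\<And>w. \<bar>W w\<bar> \<le> K" and f: "\<And>n. \<bar>f n\<bar> \<le> L"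
  shows "(\<lambda>n. f n * (\<integral>w. W w * indicator {n} (X w) \<partial>M)) sums (\<integral>w. W w * f (X w) \<partial>M)"
proof -
  have K: "0 \<le> K" and L: "0 \<le> L" using W f by (meson abs_ge_zero order_trans)+
  have fm [measurable]: "f \<in> borel_measurable (count_space UNIV)" by simp
  have int: "integrable M (\<lambda>w. W w * g (X w))" if "\<And>n. \<bar>g n\<bar> \<le> L'" for g :: "nat \<Rightarrow> real" and L'
  proof -
    have [measurable]: "g \<in> borel_measurable (count_space UNIV)" by simp
    have "\<bar>W w * g (X w)\<bar> \<le> K * L'" for w
      unfolding abs_mult using W that K by (intro mult_mono) auto
    then show ?thesis by (intro integrable_const_bound[of _ "K * L'"]) auto
  qed
  have "(\<lambda>N. \<integral>w. W w * (if X w < N then f (X w) else 0) \<partial>M) \<longlonglongrightarrow> (\<integral>w. W w * f (X w) \<partial>M)"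
  proof (rule integral_dominated_convergence[where w = "\<lambda>_. K * L"])
    show "AE w in M. (\<lambda>N. W w * (if X w < N then f (X w) else 0)) \<longlonglongrightarrow> W w * f (X w)"
    proof (rule AE_I2)
      fix w
      have "eventually (\<lambda>N. W w * f (X w) = W w * (if X w < N then f (X w) else 0)) sequentially"
        using eventually_gt_at_top[of "X w"] by eventually_elim simp
      then show "(\<lambda>N. W w * (if X w < N then f (X w) else 0)) \<longlonglongrightarrow> W w * f (X w)"
        by (rule Lim_transform_eventually[OF tendsto_const])
    qed
    show "AE w in M. norm (W w * (if X w < N then f (X w) else 0)) \<le> K * L" for N
      using W f K L by (intro AE_I2) (auto simp: abs_mult intro!: mult_mono)
  qed (auto)
  moreover have "(\<integral>w. W w * (if X w < N then f (X w) else 0) \<partial>M)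
      = (\<Sum>n<N. f n * (\<integral>w. W w * indicator {n} (X w) \<partial>M))" for N
  proof -
    have "W w * (if X w < N then f (X w) else 0) = (\<Sum>n<N. f n * (W w * indicator {n} (X w)))" for w
    proof -
      have "(\<Sum>n<N. f n * (W w * indicator {n} (X w))) = (\<Sum>n<N. if n = X w then W w * f n else 0)"
        by (intro sum.cong) (auto simp: indicator_def)
      then show ?thesis by simp
    qed
    then have "(\<integral>w. W w * (if X w < N then f (X w) else 0) \<partial>M)
        = (\<integral>w. (\<Sum>n<N. f n * (W w * indicator {n} (X w))) \<partial>M)" by simp
    also have "\<dots> = (\<Sum>n<N. f n * (\<integral>w. W w * indicator {n} (X w) \<partial>M))"
      using int[of "indicator {_}" 1] by (subst Bochner_Integration.integral_sum) (auto simp: indicator_def)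
    finally show ?thesis .
  qed
  ultimately show ?thesis by (simp add: sums_def)
qed

text \<open>The factors \<open>W1\<close> and \<open>W2\<close> carry the remaining coordinates, so
  that powers can be traded for arbitrary bounded functions in one coordinate at a time.\<close>

lemma generating_function_determines:
  fixes W1 :: "'a \<Rightarrow> real" and W2 :: "'b \<Rightarrow> real" and f :: "nat \<Rightarrow> real"
  assumes M: "finite_measure M1" "finite_measure M2"
    and [measurable]: "W1 \<in> borel_measurable M1" "X1 \<in> M1 \<rightarrow>\<^sub>M count_space UNIV"
      "W2 \<in> borel_measurable M2" "X2 \<in> M2 \<rightarrow>\<^sub>M count_space UNIV"
    and W: "\<And>w. \<bar>W1 w\<bar> \<le> K" "\<And>w. \<bar>W2 w\<bar> \<le> K"
    and gf: "\<And>z. 0 < z \<Longrightarrow> z < 1 \<Longrightarrow> (\<integral>w. W1 w * z ^ X1 w \<partial>M1) = (\<integral>w. W2 w * z ^ X2 w \<partial>M2)"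
    and f: "\<And>n. \<bar>f n\<bar> \<le> L"
  shows "(\<integral>w. W1 w * f (X1 w) \<partial>M1) = (\<integral>w. W2 w * f (X2 w) \<partial>M2)"
proof -
  interpret M1: finite_measure M1 by (rule M)
  interpret M2: finite_measure M2 by (rule M)
  define a1 where "a1 n = (\<integral>w. W1 w * indicator {n} (X1 w) \<partial>M1)" for n
  define a2 where "a2 n = (\<integral>w. W2 w * indicator {n} (X2 w) \<partial>M2)" for n
  have s1: "(\<lambda>n. g n * a1 n) sums (\<integral>w. W1 w * g (X1 w) \<partial>M1)"
    and s2: "(\<lambda>n. g n * a2 n) sums (\<integral>w. W2 w * g (X2 w) \<partial>M2)"
    if "\<And>n. \<bar>g n\<bar> \<le> L'" for g :: "nat \<Rightarrow> real" and L'
    unfolding a1_def a2_def using W that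
    by (auto intro!: M1.integral_nat_fun_sums M2.integral_nat_fun_sums)
  have "a1 n - a2 n = 0" for n
  proof (rule power_series_unique)
    fix n
    have K: "0 \<le> K" using W(1) by (meson abs_ge_zero order_trans)
    have "\<bar>a1 n\<bar> \<le> (\<integral>w. K \<partial>M1)" unfolding a1_def
      by (rule integral_abs_bound[THEN order_trans], rule integral_mono')
        (use W K in \<open>auto simp: indicator_def\<close>)
    moreover have "\<bar>a2 n\<bar> \<le> (\<integral>w. K \<partial>M2)" unfolding a2_def
      by (rule integral_abs_bound[THEN order_trans], rule integral_mono')
        (use W K in \<open>auto simp: indicator_def\<close>)
    ultimately show "\<bar>a1 n - a2 n\<bar> \<le> (\<integral>w. K \<partial>M1) + (\<integral>w. K \<partial>M2)" by linarith
  next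
    fix z :: real assume z: "0 < z" "z < 1"
    have "\<bar>z ^ n\<bar> \<le> 1" for n using z by (simp add: power_le_one)
    from sums_diff[OF s1[of "\<lambda>n. z ^ n" 1, OF this] s2[of "\<lambda>n. z ^ n" 1, OF this]] gf[OF z]
    show "(\<lambda>n. (a1 n - a2 n) * z ^ n) sums 0"
      by (simp add: algebra_simps)
  qed
  then have "a1 = a2" by (auto simp: fun_eq_iff)
  then show ?thesis
    using sums_unique2[OF s1[of f L, OF f]] s2[of f L, OF f] by simp
qed

abbreviation count_sequences :: "(nat \<Rightarrow> nat) measure" where
  "count_sequences \<equiv> PiM UNIV (\<lambda>_. count_space UNIV)"

text \<open>Powers are replaced by bounded functions coordinate by coordinate; indicator functions
  then yield the cylinder sets, which determine a finite measure on sequences.\<close>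

lemma measure_eqI_generating_function:
  assumes M: "finite_measure M" "finite_measure N"
    and sets: "sets M = sets count_sequences" "sets N = sets count_sequences"
    and gf: "\<And>(z :: nat \<Rightarrow> real) k. (\<And>i. 0 < z i) \<Longrightarrow> (\<And>i. z i < 1) \<Longrightarrow>
      (\<integral>s. (\<Prod>i<k. z i ^ s i) \<partial>M) = (\<integral>s. (\<Prod>i<k. z i ^ s i) \<partial>(N :: (nat \<Rightarrow> nat) measure))"
  shows "M = N"
proof -
  interpret M: finite_measure M by (rule M)
  interpret N: finite_measure N by (rule M)
  have [measurable_cong]: "sets M = sets count_sequences" "sets N = sets count_sequences"
    by (rule sets)+
  have sp: "space M = UNIV" "space N = UNIV"
    using sets_eq_imp_space_eq[OF sets(1)] sets_eq_imp_space_eq[OF sets(2)]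
    by (auto simp: space_PiM)
  have any [measurable]: "f \<in> borel_measurable (count_space UNIV)" for f :: "nat \<Rightarrow> real" by simp
  \<comment> \<open>In the induction on \<open>j\<close>, the coordinates below \<open>j\<close>
    carry arbitrary bounded functions, and those from \<open>j\<close> up to \<open>k\<close> still
    carry powers.\<close>
  have main: "(\<integral>s. (\<Prod>i<k. f i (s i)) \<partial>M) = (\<integral>s. (\<Prod>i<k. f i (s i)) \<partial>N)"
    if "j \<le> k" "\<And>i n. \<bar>f i n\<bar> \<le> (1 :: real)"
      "\<And>i. j \<le> i \<Longrightarrow> i < k \<Longrightarrow> \<exists>z. 0 < z \<and> z < 1 \<and> f i = (\<lambda>n. z ^ n)" for j k f
    using that
  proof (induction j arbitrary: f)
    case 0
    have "\<forall>i. \<exists>z. i < k \<longrightarrow> 0 < z \<and> z < 1 \<and> f i = (\<lambda>n. z ^ n)"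
      using 0(3) by blast
    from choice[OF this] obtain z where z: "\<And>i. i < k \<Longrightarrow> 0 < z i \<and> z i < 1 \<and> f i = (\<lambda>n. z i ^ n)"
      by blast
    \<comment> \<open>The value 1/2 is a filler beyond \<open>k\<close>: the hypothesis asks for all
      parameters to lie strictly between 0 and 1.\<close>
    define y where "y i = (if i < k then z i else 1 / 2)" for i
    have "(\<Prod>i<k. f i (s i)) = (\<Prod>i<k. y i ^ s i)" for s
      using z by (intro prod.cong) (auto simp: y_def)
    moreover have "0 < y i" "y i < 1" for i using z by (auto simp: y_def)
    ultimately show ?case using gf[of y k] by simp
  next
    case (Suc j)
    define W where "W s = (\<Prod>i\<in>{..<k} - {j}. f i (s i))" for s
    have split: "(\<Prod>i<k. (f(j := g)) i (s i)) = W s * g (s j)" for s g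
    proof -
      have "(\<Prod>i<k. (f(j := g)) i (s i)) = (f(j := g)) j (s j) * (\<Prod>i\<in>{..<k} - {j}. (f(j := g)) i (s i))"
        using Suc.prems(1) by (intro prod.remove) auto
      also have "(\<Prod>i\<in>{..<k} - {j}. (f(j := g)) i (s i)) = W s"
        unfolding W_def by (intro prod.cong) auto
      finally show ?thesis by simp
    qed
    have W1: "\<bar>W s\<bar> \<le> 1" for s
      unfolding W_def abs_prod using Suc.prems(2) by (intro prod_le_1) auto
    have [measurable]: "W \<in> borel_measurable M" "W \<in> borel_measurable N"
      unfolding W_def[abs_def] by measurable
    have "(\<integral>s. W s * f j (s j) \<partial>M) = (\<integral>s. W s * f j (s j) \<partial>N)"
    proof (rule generating_function_determines[OF M, where K = 1 and L = 1])
      fix z :: real assume z: "0 < z" "z < 1"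
      have "(\<integral>s. (\<Prod>i<k. (f(j := (\<lambda>n. z ^ n))) i (s i)) \<partial>M) = (\<integral>s. (\<Prod>i<k. (f(j := (\<lambda>n. z ^ n))) i (s i)) \<partial>N)"
      proof (rule Suc.IH)
        show "\<bar>(f(j := (\<lambda>n. z ^ n))) i n\<bar> \<le> 1" for i n
          using z Suc.prems(2) by (auto simp: power_le_one)
        show "\<exists>y. 0 < y \<and> y < 1 \<and> (f(j := (\<lambda>n. z ^ n))) i = (\<lambda>n. y ^ n)" if "j \<le> i" "i < k" for i
          using z Suc.prems(3)[of i] that by (cases "i = j") auto
      qed (use Suc.prems in auto)
      then show "(\<integral>s. W s * z ^ s j \<partial>M) = (\<integral>s. W s * z ^ s j \<partial>N)"
        unfolding split .
    qed (use W1 Suc.prems(2) in auto)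
    then show ?case
      using split[where g = "f j"] by simp
  qed
  show ?thesis
  proof (rule measure_eqI_PiM_infinite[OF sets])
    fix A :: "nat \<Rightarrow> nat set" and J :: "nat set"
    assume J: "finite J"
    obtain k where k: "J \<subseteq> {..<k}" using J finite_nat_iff_bounded by auto
    \<comment> \<open>Coordinates outside \<open>J\<close> get the constant function 1, which
      extends the cylinder from \<open>J\<close> to an initial segment.\<close>
    define f where "f i = (\<lambda>n. indicator (if i \<in> J then A i else UNIV) n :: real)" for i
    define E where "E = prod_emb UNIV (\<lambda>_. count_space UNIV) J (Pi\<^sub>E J A)"
    have E: "indicator E s = (\<Prod>i<k. f i (s i))" for s :: "nat \<Rightarrow> nat"
    proof -
      have "(\<Prod>i<k. f i (s i)) = (\<Prod>i\<in>J. indicator (A i) (s i) :: real)"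
        using k by (intro prod.mono_neutral_cong_right) (auto simp: f_def)
      also have "\<dots> = indicator E s"
      proof (cases "\<forall>i\<in>J. s i \<in> A i")
        case True
        then have "s \<in> E"
          by (auto simp: E_def prod_emb_def space_PiM PiE_def restrict_def extensional_def)
        with True show ?thesis by simp
      next
        case False
        then have "s \<notin> E" by (auto simp: E_def prod_emb_def)
        moreover have "(\<Prod>i\<in>J. indicator (A i) (s i) :: real) = 0"
        proof -
          obtain i where "i \<in> J" "s i \<notin> A i" using False by blast
          then show ?thesis by (intro prod_zero J bexI[of _ i]) auto
        qed
        ultimately show ?thesis by simp
      qed
      finally show ?thesis by simp
    qed
    have "E \<in> sets count_sequences"
      unfolding E_def by (rule sets_PiM_I) (simp_all add: J)
    then have Es [measurable]: "E \<in> sets M" "E \<in> sets N" using sets by auto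
    have "(\<integral>s. indicator E s \<partial>M) = (\<integral>s. (indicator E s :: real) \<partial>N)"
      unfolding E by (rule main[of k]) (auto simp: f_def indicator_def)
    then have "measure M E = measure N E" by simp
    then show "emeasure M (prod_emb UNIV (\<lambda>_. count_space UNIV) J (Pi\<^sub>E J A))
        = emeasure N (prod_emb UNIV (\<lambda>_. count_space UNIV) J (Pi\<^sub>E J A))"
      unfolding E_def[symmetric] by (simp add: M.emeasure_eq_measure N.emeasure_eq_measure)
  qed (rule M)
qed

section \<open>Configurations\<close>

lemma emeasure_point_measure_insert:
  assumes "B \<in> sets borel" "x \<notin> \<omega>"
  shows "emeasure (point_measure_of (insert x \<omega>)) B = emeasure (point_measure_of \<omega>) B + indicator B x"
proof (cases "x \<in> B")
  case True
  then have "insert x \<omega> \<inter> B = insert x (\<omega> \<inter> B)" by auto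
  moreover have "emeasure (count_space UNIV) (insert x (\<omega> \<inter> B))
      = emeasure (count_space UNIV) {x} + emeasure (count_space UNIV) (\<omega> \<inter> B)"
    using assms by (subst plus_emeasure) auto
  ultimately show ?thesis
    using True assms by (simp add: emeasure_point_measure_of add.commute)
next
  case False
  then have "insert x \<omega> \<inter> B = \<omega> \<inter> B" by auto
  then show ?thesis using False assms by (simp add: emeasure_point_measure_of)
qed

lemma sets_point_measure_of [simp]: "sets (point_measure_of \<omega>) = sets borel"
  by (simp add: point_measure_of_def)

text \<open>A new point adds at most 1 to the measure of a neighbourhood, and a compact set remains
  compact when the point is added to it, so inner regularity survives. The lemma serves the
  gradient: \<open>F\<close> is a function of counts on \<open>configurations\<close> only, yet it
  is evaluated at \<open>insert x \<omega>\<close>.\<close>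

lemma insert_in_configurations:
  assumes "\<omega> \<in> configurations"
  shows "insert x \<omega> \<in> configurations"
proof (cases "x \<in> \<omega>")
  case False
  have count: "countable \<omega>" and rad: "radon_measure (point_measure_of \<omega>)"
    using assms by (auto simp: configurations_def)
  let ?M = "point_measure_of \<omega>" and ?M' = "point_measure_of (insert x \<omega>)"
  have M': "emeasure ?M' B = emeasure ?M B + indicator B x" if "B \<in> sets borel" for B
    using that False by (rule emeasure_point_measure_insert)
  have "\<exists>U. open U \<and> y \<in> U \<and> emeasure ?M' U < \<infinity>" for y
  proof -
    obtain U where U: "open U" "y \<in> U" "emeasure ?M U < \<infinity>"
      using rad unfolding radon_measure_def by blast
    then have "emeasure ?M' U < \<infinity>"
      by (subst M') (auto simp: indicator_def)
    with U show ?thesis by blast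
  qed
  moreover have "emeasure ?M' B = (SUP K \<in> {K. compact K \<and> K \<subseteq> B}. emeasure ?M' K)"
    if B: "B \<in> sets borel" for B
  proof (rule antisym)
    have regular: "emeasure ?M B = (SUP K \<in> {K. compact K \<and> K \<subseteq> B}. emeasure ?M K)"
      using rad B by (auto simp: radon_measure_def)
    have ne: "{K. compact K \<and> K \<subseteq> B} \<noteq> {}"
      by (auto intro!: exI[of _ "{}"])
    have "emeasure ?M' B = (SUP K \<in> {K. compact K \<and> K \<subseteq> B}. emeasure ?M K + indicator B x)"
      unfolding M'[OF B] regular by (rule ennreal_SUP_add_left[OF ne, symmetric])
    also have "\<dots> \<le> (SUP K \<in> {K. compact K \<and> K \<subseteq> B}. emeasure ?M' K)"
    proof (rule SUP_mono)
      fix K assume "K \<in> {K. compact K \<and> K \<subseteq> B}"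
      then have K: "compact K" "K \<subseteq> B" by auto
      define K' where "K' = (if x \<in> B then insert x K else K)"
      have K': "compact K'" "K' \<subseteq> B"
        using K by (auto simp: K'_def)
      have "emeasure ?M K \<le> emeasure ?M K'"
        using K' by (intro emeasure_mono) (auto simp: K'_def borel_compact)
      moreover have "indicator B x \<le> (indicator K' x :: ennreal)"
        by (auto simp: K'_def indicator_def)
      ultimately have "emeasure ?M K + indicator B x \<le> emeasure ?M' K'"
        unfolding M'[OF borel_compact[OF K'(1)]] by (rule add_mono)
      with K' show "\<exists>K'\<in>{K. compact K \<and> K \<subseteq> B}. emeasure ?M K + indicator B x \<le> emeasure ?M' K'"
        by blast
    qed
    finally show "emeasure ?M' B \<le> (SUP K \<in> {K. compact K \<and> K \<subseteq> B}. emeasure ?M' K)" .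
    show "(SUP K \<in> {K. compact K \<and> K \<subseteq> B}. emeasure ?M' K) \<le> emeasure ?M' B"
      using B by (intro SUP_least emeasure_mono) auto
  qed
  ultimately show ?thesis
    using count by (auto simp: configurations_def radon_measure_def)
qed (use assms in \<open>simp add: insert_absorb\<close>)

lemma space_configuration_space: "space configuration_space = configurations"
  unfolding configuration_space_def by (rule space_measure_of) auto

lemma sets_configuration_space:
  "sets configuration_space = sigma_sets configurations
     {(\<lambda>\<omega>. emeasure (point_measure_of \<omega>) B) -` S \<inter> configurations | B S.
        B \<in> sets borel \<and> S \<in> sets (borel :: ennreal measure)}"
  unfolding configuration_space_def by (rule sets_measure_of) auto

lemma measurable_count [measurable]:
  assumes "B \<in> sets borel"
  shows "(\<lambda>\<omega>. emeasure (point_measure_of \<omega>) B) \<in> borel_measurable configuration_space"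
proof (rule measurableI)
  fix S :: "ennreal set" assume "S \<in> sets borel"
  then show "(\<lambda>\<omega>. emeasure (point_measure_of \<omega>) B) -` S \<inter> space configuration_space \<in> sets configuration_space"
    using assms unfolding space_configuration_space sets_configuration_space by blast
qed simp

abbreviation enn_sequences :: "(nat \<Rightarrow> ennreal) measure" where
  "enn_sequences \<equiv> PiM UNIV (\<lambda>_. borel)"

lemma space_enn_sequences [simp]: "space enn_sequences = UNIV"
  by (simp add: space_PiM)

text \<open>Sets with such a description contain the generators and form a \<sigma>-algebra. For a
  countable union, the sequences of Borel sets are merged into one by the pairing function.\<close>

lemma configuration_space_set_countable_counts:
  assumes "A \<in> sets configuration_space"
  shows "\<exists>B E. (\<forall>i::nat. B i \<in> sets borel) \<and> E \<in> sets enn_sequences \<and>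
    A = {\<omega> \<in> configurations. (\<lambda>i. emeasure (point_measure_of \<omega>) (B i)) \<in> E}"
  using assms unfolding sets_configuration_space
proof induction
  case (Basic A)
  then obtain B S where BS: "B \<in> sets borel" "S \<in> sets (borel :: ennreal measure)"
    "A = (\<lambda>\<omega>. emeasure (point_measure_of \<omega>) B) -` S \<inter> configurations" by blast
  have "(\<lambda>s. s 0) \<in> enn_sequences \<rightarrow>\<^sub>M borel"
    by (rule measurable_component_singleton) simp
  then have "(\<lambda>s. s 0) -` S \<inter> space enn_sequences \<in> sets enn_sequences"
    using BS(2) by (rule measurable_sets)
  then show ?case
    using BS by (intro exI[of _ "\<lambda>_. B"] exI[of _ "(\<lambda>s. s 0) -` S"]) auto
next
  case Empty
  show ?case by (intro exI[of _ "\<lambda>_. {}"] exI[of _ "{}"]) auto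
next
  case (Compl A)
  then obtain B E where BE: "\<forall>i::nat. B i \<in> sets borel" "E \<in> sets enn_sequences"
    "A = {\<omega> \<in> configurations. (\<lambda>i. emeasure (point_measure_of \<omega>) (B i)) \<in> E}" by blast
  have "space enn_sequences - E \<in> sets enn_sequences" using BE by blast
  then show ?case
    using BE by (intro exI[of _ B] exI[of _ "- E"]) (auto simp: Compl_eq_Diff_UNIV)
next
  case (Union A)
  then have "\<forall>n. \<exists>B E. (\<forall>i::nat. B i \<in> sets borel) \<and> E \<in> sets enn_sequences \<and>
    A n = {\<omega> \<in> configurations. (\<lambda>i. emeasure (point_measure_of \<omega>) (B i)) \<in> E}" by blast
  then obtain B E where BE: "\<And>n i. B n i \<in> sets borel" "\<And>n. E n \<in> sets enn_sequences"
    "\<And>n. A n = {\<omega> \<in> configurations. (\<lambda>i. emeasure (point_measure_of \<omega>) (B n i)) \<in> E n}"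
    unfolding choice_iff by blast
  define B' where "B' j = (case prod_decode j of (n, i) \<Rightarrow> B n i)" for j
  define E' where "E' = (\<Union>n. (\<lambda>s i. s (prod_encode (n, i))) -` E n \<inter> space enn_sequences)"
  have "(\<lambda>s i. s (prod_encode (n, i))) \<in> enn_sequences \<rightarrow>\<^sub>M enn_sequences" for n
    by (rule measurable_PiM_single') auto
  from measurable_sets[OF this BE(2)] have "E' \<in> sets enn_sequences"
    unfolding E'_def by (intro sets.countable_UN) blast
  moreover have "(\<Union>n. A n) = {\<omega> \<in> configurations. (\<lambda>i. emeasure (point_measure_of \<omega>) (B' i)) \<in> E'}"
    unfolding BE(3) E'_def B'_def by auto
  moreover have "B' j \<in> sets borel" for j
    using BE(1) by (auto simp: B'_def split: prod.split)
  ultimately show ?case by blast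
qed

text \<open>\<open>F\<close> is the supremum of rationals \<open>q\<close> times the indicators of
  \<open>q < F\<close>, and each of these sets depends on countably many counts. The same supremum
  on sequences defines \<open>g\<close> with values in \<open>[0, 1]\<close> everywhere, also at
  sequences that no configuration produces.\<close>

lemma configuration_space_fun_countable_counts:
  fixes F :: "'a::metric_space set \<Rightarrow> real"
  assumes F [measurable]: "F \<in> borel_measurable configuration_space"
    and F01: "\<forall>\<omega>\<in>configurations. 0 \<le> F \<omega> \<and> F \<omega> \<le> 1"
  obtains B g where "\<And>i::nat. B i \<in> sets borel" "g \<in> borel_measurable enn_sequences"
    "\<And>s. 0 \<le> g s" "\<And>s. g s \<le> 1"
    "\<And>\<omega>. \<omega> \<in> configurations \<Longrightarrow> F \<omega> = g (\<lambda>i. emeasure (point_measure_of \<omega>) (B i))"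
proof -
  \<comment> \<open>Rationals outside the unit interval are sent to 0, which keeps \<open>q\<close>
    an enumeration within \<open>[0, 1]\<close>.\<close>
  define q :: "nat \<Rightarrow> real" where "q n = (let r = real_of_rat (nat_to_rat_surj n) in if 0 \<le> r \<and> r \<le> 1 then r else 0)" for n
  have q: "0 \<le> q n" "q n \<le> 1" for n by (auto simp: q_def Let_def)
  have dense: "\<exists>n. y < q n \<and> q n < z" if "0 \<le> y" "y < z" "z \<le> 1" for y z
  proof -
    obtain r where r: "y < real_of_rat r" "real_of_rat r < z" using of_rat_dense[OF \<open>y < z\<close>] by blast
    obtain n where "r = nat_to_rat_surj n" using surj_nat_to_rat_surj by (metis surjD)
    moreover have "0 \<le> real_of_rat r" "real_of_rat r \<le> 1" using r that by linarith+
    ultimately have "q n = real_of_rat r" by (simp add: q_def)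
    with r show ?thesis by (intro exI[of _ n]) simp
  qed
  have "{\<omega> \<in> configurations. q n < F \<omega>} \<in> sets configuration_space" for n
    unfolding space_configuration_space[symmetric] by measurable
  then have "\<forall>n. \<exists>B E. (\<forall>i::nat. B i \<in> sets borel) \<and> E \<in> sets enn_sequences \<and>
    {\<omega> \<in> configurations. q n < F \<omega>} = {\<omega> \<in> configurations. (\<lambda>i. emeasure (point_measure_of \<omega>) (B i)) \<in> E}"
    by (intro allI configuration_space_set_countable_counts)
  then obtain B E where BE: "\<And>n i. B n i \<in> sets borel" "\<And>n. E n \<in> sets enn_sequences"
    "\<And>n. {\<omega> \<in> configurations. q n < F \<omega>} = {\<omega> \<in> configurations. (\<lambda>i. emeasure (point_measure_of \<omega>) (B n i)) \<in> E n}"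
    unfolding choice_iff by blast
  define B' where "B' j = (case prod_decode j of (n, i) \<Rightarrow> B n i)" for j
  define E' where "E' n = (\<lambda>s i. s (prod_encode (n, i))) -` E n \<inter> space enn_sequences" for n
  define g where "g s = (SUP n. q n * indicator (E' n) s)" for s
  have "(\<lambda>s i. s (prod_encode (n, i))) \<in> enn_sequences \<rightarrow>\<^sub>M enn_sequences" for n
    by (rule measurable_PiM_single') auto
  then have E' [measurable]: "E' n \<in> sets enn_sequences" for n
    unfolding E'_def using BE(2) by (intro measurable_sets)
  have bdd: "bdd_above (range (\<lambda>n. q n * indicator (E' n) s))" for s
    using q by (intro bdd_aboveI[of _ 1]) (auto simp: indicator_def)
  show ?thesis
  proof (rule that)
    show "B' j \<in> sets borel" for j
      using BE(1) by (auto simp: B'_def split: prod.split)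
    show "g \<in> borel_measurable enn_sequences"
      unfolding g_def[abs_def] using bdd by (intro borel_measurable_cSUP) auto
    show "0 \<le> g s" for s
      unfolding g_def by (rule cSUP_upper2[OF bdd, of _ 0]) (use q in auto)
    show "g s \<le> 1" for s
      unfolding g_def using q by (intro cSUP_least) (auto simp: indicator_def)
    fix \<omega> :: "'a set" assume \<omega>: "\<omega> \<in> configurations"
    define s where "s = (\<lambda>i. emeasure (point_measure_of \<omega>) (B' i))"
    have ind: "indicator (E' n) s = (if q n < F \<omega> then 1 else 0 :: real)" for n
      using \<omega> BE(3)[of n] by (auto simp: E'_def s_def B'_def set_eq_iff indicator_def)
    show "F \<omega> = g s"
    proof (rule antisym)
      show "g s \<le> F \<omega>"
        unfolding g_def ind using F01 \<omega> by (intro cSUP_least) auto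
      show "F \<omega> \<le> g s"
      proof (rule ccontr)
        assume "\<not> F \<omega> \<le> g s"
        then have "g s < F \<omega>" by simp
        then obtain n where n: "g s < q n" "q n < F \<omega>"
          using dense[of "g s" "F \<omega>"] \<open>\<And>s. 0 \<le> g s\<close> F01 \<omega> by auto
        have "q n * indicator (E' n) s \<le> g s"
          unfolding g_def by (rule cSUP_upper[OF _ bdd]) simp
        with n show False by (simp add: ind)
      qed
    qed
  qed
qed

section \<open>The law of the counts\<close>

locale poisson_process = finite_measure \<sigma> for \<sigma> :: "'a::metric_space measure" +
  fixes \<pi> :: "'a set measure"
  assumes sets_\<sigma>: "sets \<sigma> = sets borel"
    and poisson: "poisson_measure \<sigma> \<pi>"
begin

sublocale \<pi>: prob_space \<pi>
  using poisson by (simp add: poisson_measure_def)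

lemma sets_\<pi> [measurable_cong]: "sets \<pi> = sets configuration_space"
  using poisson by (simp add: poisson_measure_def)

lemmas sets_\<sigma>_cong [measurable_cong] = sets_\<sigma>

lemma space_\<sigma>: "space \<sigma> = UNIV"
  using sets_eq_imp_space_eq[OF sets_\<sigma>] by simp

lemma space_\<pi>: "space \<pi> = configurations"
  using sets_eq_imp_space_eq[OF sets_\<pi>] by (simp add: space_configuration_space)

text \<open>The default value at an infinite count is 0; this affects only a null set of
  configurations.\<close>

definition num :: "'a set \<Rightarrow> 'a set \<Rightarrow> nat" where
  "num B \<omega> = nat \<lfloor>enn2real (emeasure (point_measure_of \<omega>) B)\<rfloor>"

lemma measurable_count_\<pi>:
  "B \<in> sets borel \<Longrightarrow> (\<lambda>\<omega>. emeasure (point_measure_of \<omega>) B) \<in> borel_measurable \<pi>"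
  using measurable_count[of B] by (simp cong: measurable_cong_sets add: sets_\<pi>)

lemma sets_count_eq:
  assumes "B \<in> sets borel"
  shows "{\<omega> \<in> space \<pi>. emeasure (point_measure_of \<omega>) B = c} \<in> sets \<pi>"
proof -
  have "(\<lambda>\<omega>. emeasure (point_measure_of \<omega>) B) -` {c} \<inter> space \<pi> \<in> sets \<pi>"
    by (rule measurable_sets[OF measurable_count_\<pi>[OF assms]]) simp
  moreover have "(\<lambda>\<omega>. emeasure (point_measure_of \<omega>) B) -` {c} \<inter> space \<pi>
      = {\<omega> \<in> space \<pi>. emeasure (point_measure_of \<omega>) B = c}" by auto
  ultimately show ?thesis by simp
qed

lemma measurable_enn_floor [measurable]:
  "(\<lambda>y. nat \<lfloor>enn2real y\<rfloor>) \<in> borel \<rightarrow>\<^sub>M count_space UNIV"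
proof -
  have "nat \<in> count_space UNIV \<rightarrow>\<^sub>M count_space UNIV" by simp
  then show ?thesis by measurable
qed

lemma measurable_num [measurable]: "B \<in> sets borel \<Longrightarrow> num B \<in> \<pi> \<rightarrow>\<^sub>M count_space UNIV"
  unfolding num_def[abs_def] by (rule measurable_compose[OF measurable_count_\<pi> measurable_enn_floor])

lemma emeasure_point_measure_finite:
  assumes "finite \<omega>" "B \<in> sets borel"
  shows "emeasure (point_measure_of \<omega>) B = of_nat (card (\<omega> \<inter> B))"
  using assms by (simp add: emeasure_point_measure_of emeasure_count_space)

lemma num_finite:
  assumes "finite \<omega>" "B \<in> sets borel"
  shows "num B \<omega> = card (\<omega> \<inter> B)"
  using assms by (simp add: num_def emeasure_point_measure_finite ennreal_of_nat_eq_real_of_nat)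

lemma sums_poisson_weights: "(\<lambda>k. exp (- a) * a ^ k / fact k * z ^ k) sums exp (a * (z - 1))" for a z :: real
proof -
  have "(\<lambda>k. exp (- a) * ((a * z) ^ k /\<^sub>R fact k)) sums (exp (- a) * exp (a * z))"
    by (intro sums_mult exp_converges)
  moreover have "exp (- a) * exp (a * z) = exp (a * (z - 1))"
    by (simp add: exp_add[symmetric] algebra_simps)
  ultimately show ?thesis
    by (simp add: power_mult_distrib field_simps)
qed

text \<open>Since \<open>\<sigma>\<close> is finite, the Poisson weights of the total count sum to
  1, which leaves no mass for infinitely many points.\<close>

lemma AE_finite: "AE \<omega> in \<pi>. finite \<omega>"
proof -
  let ?A = "\<lambda>k::nat. {\<omega> \<in> space \<pi>. emeasure (point_measure_of \<omega>) UNIV = of_nat k}"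
  have A: "?A k \<in> sets \<pi>" for k by (rule sets_count_eq) simp
  have sums: "(\<lambda>k. measure \<pi> (?A k)) sums measure \<pi> (\<Union>k. ?A k)"
    by (intro \<pi>.finite_measure_UNION) (use A in \<open>auto simp: disjoint_family_on_def\<close>)
  \<comment> \<open>The factor \<open>1 ^ k\<close> brings the weights into the form of the
    generating function at \<open>z = 1\<close>.\<close>
  have weight: "measure \<pi> (?A k) = exp (- measure \<sigma> UNIV) * measure \<sigma> UNIV ^ k / fact k * 1 ^ k" for k
    using poisson unfolding poisson_measure_def by simp
  have "measure \<pi> (\<Union>k. ?A k) = exp (measure \<sigma> UNIV * (1 - 1))"
    using sums unfolding weight by (rule sums_unique2[OF _ sums_poisson_weights])
  then have "AE \<omega> in \<pi>. \<omega> \<in> (\<Union>k. ?A k)"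
    using A by (subst \<pi>.AE_in_set_eq_1) auto
  then show ?thesis
  proof eventually_elim
    case (elim \<omega>)
    then show ?case
      by (auto simp: emeasure_point_measure_of emeasure_count_space split: if_splits)
  qed
qed

lemma generating_function_num:
  assumes B: "B \<in> sets borel" and z: "0 < z" "z \<le> 1"
  shows "(\<integral>\<omega>. z ^ num B \<omega> \<partial>\<pi>) = exp (measure \<sigma> B * (z - 1))"
proof -
  note B[measurable]
  have "(\<lambda>n. z ^ n * (\<integral>\<omega>. 1 * indicator {n} (num B \<omega>) \<partial>\<pi>)) sums (\<integral>\<omega>. 1 * z ^ num B \<omega> \<partial>\<pi>)"
    using z by (intro \<pi>.integral_nat_fun_sums[of _ _ 1 _ 1]) (auto simp: power_le_one)
  moreover have "(\<integral>\<omega>. 1 * indicator {n} (num B \<omega>) \<partial>\<pi>) = exp (- measure \<sigma> B) * measure \<sigma> B ^ n / fact n" for n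
  proof -
    have "(\<integral>\<omega>. 1 * indicator {n} (num B \<omega>) \<partial>\<pi>)
        = (\<integral>\<omega>. (indicator {\<omega> \<in> space \<pi>. emeasure (point_measure_of \<omega>) B = of_nat n} \<omega> :: real) \<partial>\<pi>)"
    proof (rule integral_cong_AE)
      show "AE \<omega> in \<pi>. 1 * indicator {n} (num B \<omega>)
          = (indicator {\<omega> \<in> space \<pi>. emeasure (point_measure_of \<omega>) B = of_nat n} \<omega> :: real)"
        using AE_finite AE_space
      proof eventually_elim
        case (elim \<omega>)
        then show ?case
          using B by (auto simp: num_finite emeasure_point_measure_finite indicator_def)
      qed
      show "(\<lambda>\<omega>. 1 * indicator {n} (num B \<omega>) :: real) \<in> borel_measurable \<pi>"
        by (rule measurable_compose[OF measurable_num[OF B]]) simp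
      show "(indicator {\<omega> \<in> space \<pi>. emeasure (point_measure_of \<omega>) B = of_nat n} :: _ \<Rightarrow> real)
          \<in> borel_measurable \<pi>"
        by (rule borel_measurable_indicator[OF sets_count_eq[OF B]])
    qed
    also have "\<dots> = measure \<pi> {\<omega> \<in> space \<pi>. emeasure (point_measure_of \<omega>) B = of_nat n}"
      by simp
    also have "\<dots> = exp (- measure \<sigma> B) * measure \<sigma> B ^ n / fact n"
      using poisson B unfolding poisson_measure_def by blast
    finally show ?thesis .
  qed
  ultimately have "(\<lambda>n. exp (- measure \<sigma> B) * measure \<sigma> B ^ n / fact n * z ^ n) sums (\<integral>\<omega>. z ^ num B \<omega> \<partial>\<pi>)"
    by (simp add: mult_ac)
  then show ?thesis
    by (rule sums_unique2[OF _ sums_poisson_weights])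
qed

lemma generating_function_nums_disjoint:
  fixes D :: "nat \<Rightarrow> 'a set"
  assumes D: "\<And>j. j < r \<Longrightarrow> D j \<in> sets borel" "disjoint_family_on D {..<r}"
    and v: "\<And>j. j < r \<Longrightarrow> 0 < v j" "\<And>j. j < r \<Longrightarrow> v j \<le> 1"
  shows "(\<integral>\<omega>. (\<Prod>j<r. v j ^ num (D j) \<omega>) \<partial>\<pi>) = exp (\<Sum>j<r. measure \<sigma> (D j) * (v j - 1))"
proof -
  have "\<pi>.indep_vars (\<lambda>_. borel) (\<lambda>i \<omega>. emeasure (point_measure_of \<omega>) (D i)) {..<r}"
    using poisson D unfolding poisson_measure_def by blast
  then have "\<pi>.indep_vars (\<lambda>_. borel) (\<lambda>i \<omega>. v i ^ num (D i) \<omega>) {..<r}"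
    unfolding num_def by (rule \<pi>.indep_vars_compose2) measurable
  then have "(\<integral>\<omega>. (\<Prod>j<r. v j ^ num (D j) \<omega>) \<partial>\<pi>) = (\<Prod>j<r. \<integral>\<omega>. v j ^ num (D j) \<omega> \<partial>\<pi>)"
  proof (rule \<pi>.indep_vars_lebesgue_integral[rotated])
    fix i assume "i \<in> {..<r}"
    with D v show "integrable \<pi> (\<lambda>\<omega>. v i ^ num (D i) \<omega>)"
      by (intro \<pi>.integrable_const_bound[of _ 1]) (auto simp: power_le_one less_imp_le)
  qed simp
  also have "\<dots> = (\<Prod>j<r. exp (measure \<sigma> (D j) * (v j - 1)))"
    using D v by (intro prod.cong generating_function_num) auto
  finally show ?thesis by (simp add: exp_sum)
qed

text \<open>The Laplace functional of the Poisson process, that is, the mean of the product of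
  \<open>u x\<close> over the points of \<open>\<omega>\<close>. The sets \<open>B i\<close> may
  overlap whereas independence is given for disjoint sets, so they are traded for the level sets of
  \<open>u\<close>, of which there are finitely many.\<close>

lemma generating_function_nums:
  fixes B :: "nat \<Rightarrow> 'a set"
  assumes B: "\<And>i. B i \<in> sets borel" and z: "\<And>i. 0 < z i" "\<And>i. z i < 1"
  shows "(\<integral>\<omega>. (\<Prod>i<k. z i ^ num (B i) \<omega>) \<partial>\<pi>)
    = exp ((\<integral>x. (\<Prod>i<k. z i ^ indicator (B i) x) \<partial>\<sigma>) - measure \<sigma> UNIV)"
proof -
  note B[measurable]
  define u where "u x = (\<Prod>i<k. z i ^ indicator (B i) x)" for x
  have "u x = (\<Prod>i<k. if x \<in> B i then z i else 1)" for x
    unfolding u_def by (intro prod.cong) (auto simp: indicator_def)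
  then have u_if: "u = (\<lambda>x. \<Prod>i<k. if x \<in> B i then z i else 1)" by (rule ext)
  have u01: "0 < u x" "u x \<le> 1" for x
    unfolding u_if using z by (auto intro!: prod_pos prod_le_1 simp: less_imp_le)
  have u_meas [measurable]: "u \<in> borel_measurable borel" unfolding u_if by measurable
  \<comment> \<open>Each value of \<open>u\<close> is the product of the \<open>z i\<close> over
    those \<open>i < k\<close> for which \<open>B i\<close> contains the point.\<close>
  have "range u \<subseteq> (\<lambda>J. \<Prod>i\<in>J. z i) ` Pow {..<k}"
  proof
    fix y assume "y \<in> range u"
    then obtain x where "y = u x" by blast
    then have "y = (\<Prod>i\<in>{i. i < k \<and> x \<in> B i}. z i)"
      unfolding u_if by (auto simp: prod.If_cases intro!: prod.cong)
    then show "y \<in> (\<lambda>J. \<Prod>i\<in>J. z i) ` Pow {..<k}" by blast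
  qed
  then have fin: "finite (range u)" by (rule finite_subset) simp
  obtain v where v: "bij_betw v {..<card (range u)} (range u)"
    using ex_bij_betw_nat_finite[OF fin] by (auto simp: atLeast0LessThan)
  define r where "r = card (range u)"
  define D where "D j = u -` {v j}" for j
  have D: "D j \<in> sets borel" for j
    using measurable_sets[OF u_meas, of "{v j}"] by (simp add: D_def)
  have disj: "disjoint_family_on D {..<r}"
    using v by (auto simp: disjoint_family_on_def D_def r_def bij_betw_def inj_on_def)
  have v01: "0 < v j" "v j \<le> 1" if "j < r" for j
  proof -
    have "v j \<in> range u" using v that by (auto simp: bij_betw_def r_def)
    then show "0 < v j" "v j \<le> 1" using u01 by auto
  qed
  have ex1: "\<exists>j<r. v j = u x" for x
    using v by (metis bij_betw_def imageE lessThan_iff rangeI r_def)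
  have sum_D: "(\<Sum>j<r. f (v j) * indicator (D j) x) = f (u x)" for f :: "real \<Rightarrow> real" and x
  proof -
    obtain j where j: "j < r" "v j = u x" using ex1 by blast
    have "(\<Sum>j<r. f (v j) * indicator (D j) x) = (\<Sum>i<r. if i = j then f (u x) else 0)"
    proof (rule sum.cong[OF refl])
      fix i assume "i \<in> {..<r}"
      then have "v i = v j \<longleftrightarrow> i = j"
        using v j by (auto simp: bij_betw_def inj_on_def r_def)
      then show "f (v i) * indicator (D i) x = (if i = j then f (u x) else 0)"
        using j by (auto simp: D_def indicator_def)
    qed
    then show ?thesis using j by simp
  qed
  \<comment> \<open>For a finite configuration both integrands are the product of \<open>u x\<close>
    over its points, grouped once by the \<open>B i\<close> and once by the values of
    \<open>u\<close>.\<close>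
  have "(\<integral>\<omega>. (\<Prod>i<k. z i ^ num (B i) \<omega>) \<partial>\<pi>) = (\<integral>\<omega>. (\<Prod>j<r. v j ^ num (D j) \<omega>) \<partial>\<pi>)"
  proof (rule integral_cong_AE)
    note D[measurable]
    show "(\<lambda>\<omega>. \<Prod>i<k. z i ^ num (B i) \<omega>) \<in> borel_measurable \<pi>"
      "(\<lambda>\<omega>. \<Prod>j<r. v j ^ num (D j) \<omega>) \<in> borel_measurable \<pi>"
      by measurable
    show "AE \<omega> in \<pi>. (\<Prod>i<k. z i ^ num (B i) \<omega>) = (\<Prod>j<r. v j ^ num (D j) \<omega>)"
      using AE_finite
    proof eventually_elim
      case (elim \<omega>)
      have pow_card: "(\<Prod>x\<in>\<omega>. c ^ indicator A x) = c ^ card (\<omega> \<inter> A)" for c :: real and A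
      proof -
        have "(\<Prod>x\<in>\<omega>. c ^ indicator A x) = (\<Prod>x\<in>\<omega> \<inter> A. c)"
          using elim by (intro prod.mono_neutral_cong_right) (auto simp: indicator_def)
        then show ?thesis by simp
      qed
      have "(\<Prod>i<k. z i ^ num (B i) \<omega>) = (\<Prod>i<k. \<Prod>x\<in>\<omega>. z i ^ indicator (B i) x)"
        using elim B by (simp add: num_finite pow_card)
      also have "\<dots> = (\<Prod>x\<in>\<omega>. u x)"
        unfolding u_def by (rule prod.swap)
      also have "\<dots> = (\<Prod>x\<in>\<omega>. \<Prod>j<r. v j ^ indicator (D j) x)"
      proof (rule prod.cong[OF refl])
        fix x
        obtain j where j: "j < r" "v j = u x" using ex1 by blast
        have "(\<Prod>i<r. v i ^ indicator (D i) x) = (\<Prod>i<r. if i = j then u x else 1)"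
        proof (rule prod.cong[OF refl])
          fix i assume "i \<in> {..<r}"
          then have "v i = v j \<longleftrightarrow> i = j"
            using v j by (auto simp: bij_betw_def inj_on_def r_def)
          then show "v i ^ indicator (D i) x = (if i = j then u x else 1)"
            using j by (auto simp: D_def indicator_def)
        qed
        then show "u x = (\<Prod>j<r. v j ^ indicator (D j) x)" using j by simp
      qed
      also have "\<dots> = (\<Prod>j<r. \<Prod>x\<in>\<omega>. v j ^ indicator (D j) x)"
        by (rule prod.swap)
      also have "\<dots> = (\<Prod>j<r. v j ^ num (D j) \<omega>)"
        using elim D by (simp add: num_finite pow_card)
      finally show ?case .
    qed
  qed
  also have "\<dots> = exp (\<Sum>j<r. measure \<sigma> (D j) * (v j - 1))"
    by (rule generating_function_nums_disjoint) (use D disj v01 in auto)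
  also have "(\<Sum>j<r. measure \<sigma> (D j) * (v j - 1)) = (\<integral>x. (\<Sum>j<r. (v j - 1) * indicator (D j) x) \<partial>\<sigma>)"
    using D by (subst Bochner_Integration.integral_sum)
      (auto simp: sets_\<sigma> space_\<sigma> emeasure_eq_measure mult.commute intro!: sum.cong)
  also have "\<dots> = (\<integral>x. u x - 1 \<partial>\<sigma>)"
    using sum_D[of "\<lambda>y. y - 1"] by simp
  also have "\<dots> = (\<integral>x. u x \<partial>\<sigma>) - measure \<sigma> UNIV"
  proof -
    have "integrable \<sigma> u"
      using u01 by (intro integrable_const_bound[of _ 1]) (auto simp: less_imp_le)
    then show ?thesis by (subst Bochner_Integration.integral_diff) (auto simp: space_\<sigma>)
  qed
  finally show ?thesis by (simp add: u_def)
qed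

end

context poisson_process
begin

lemma commuting_jumps_counts:
  assumes B: "\<And>i::nat. B i \<in> sets borel"
  shows "commuting_jumps \<sigma> count_sequences (\<lambda>x s i. s i + indicator (B i) x)"
proof
  have "(\<lambda>p i. snd p i + indicator (B i) (fst p)) \<in> \<sigma> \<Otimes>\<^sub>M count_sequences \<rightarrow>\<^sub>M count_sequences"
  proof (rule measurable_PiM_single')
    fix i :: nat
    have proj [measurable]: "(\<lambda>p. snd p i) \<in> \<sigma> \<Otimes>\<^sub>M count_sequences \<rightarrow>\<^sub>M count_space UNIV"
      by (rule measurable_compose[OF measurable_snd measurable_component_singleton]) simp
    have Suc_proj: "(\<lambda>p. Suc (snd p i)) \<in> \<sigma> \<Otimes>\<^sub>M count_sequences \<rightarrow>\<^sub>M count_space UNIV"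
      by (rule measurable_compose[OF proj]) simp
    have "{p \<in> space (\<sigma> \<Otimes>\<^sub>M count_sequences). fst p \<in> B i} \<in> sets (\<sigma> \<Otimes>\<^sub>M count_sequences)"
      using measurable_sets[OF measurable_fst, of "B i" \<sigma> count_sequences] B
      by (simp add: sets_\<sigma> vimage_def Int_def conj_commute)
    then have "(\<lambda>p. if fst p \<in> B i then Suc (snd p i) else snd p i)
        \<in> \<sigma> \<Otimes>\<^sub>M count_sequences \<rightarrow>\<^sub>M count_space UNIV"
      by (rule measurable_If[OF Suc_proj proj])
    then show "(\<lambda>p. snd p i + indicator (B i) (fst p)) \<in> \<sigma> \<Otimes>\<^sub>M count_sequences \<rightarrow>\<^sub>M count_space UNIV"
      by (rule measurable_cong[THEN iffD1, rotated]) (simp add: indicator_def)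
  qed simp
  then show "(\<lambda>(x, s) i. s i + indicator (B i) x) \<in> \<sigma> \<Otimes>\<^sub>M count_sequences \<rightarrow>\<^sub>M count_sequences"
    by (simp add: split_beta')
qed (auto simp: space_\<sigma> space_PiM)

text \<open>The function is multiplicative under addition of counts, hence an eigenfunction of
  \<open>jump_int\<close> with eigenvalue \<open>a\<close>, the integral of the one-point weight. At
  the zero sequence it equals 1, and the exponential series sums to
  \<open>exp (a - mass)\<close>.\<close>

lemma jump_law_generating_function:
  assumes B: "\<And>i::nat. B i \<in> sets borel" and z: "\<And>i. 0 < z i" "\<And>i. z i < (1 :: real)"
  defines "\<tau> \<equiv> (\<lambda>x s i. s i + indicator (B i) x)"
  shows "commuting_jumps.bdd_meas count_sequences (\<lambda>s. \<Prod>i<k. z i ^ s i)"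
    and "commuting_jumps.jump_law \<sigma> \<tau> (\<lambda>_. 0) (\<lambda>s. \<Prod>i<k. z i ^ s i)
      = exp ((\<integral>x. (\<Prod>i<k. z i ^ indicator (B i) x) \<partial>\<sigma>) - measure \<sigma> UNIV)"
proof -
  interpret commuting_jumps \<sigma> count_sequences \<tau>
    unfolding \<tau>_def using B by (rule commuting_jumps_counts)
  define H where "H s = (\<Prod>i<k. z i ^ s i)" for s :: "nat \<Rightarrow> nat"
  define a where "a = (\<integral>x. (\<Prod>i<k. z i ^ indicator (B i) x) \<partial>\<sigma>)"
  show "bdd_meas (\<lambda>s. \<Prod>i<k. z i ^ s i)"
  proof (rule bdd_measI)
    show "(\<lambda>s. \<Prod>i<k. z i ^ s i) \<in> borel_measurable count_sequences"
    proof (rule borel_measurable_prod)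
      fix i
      have "(\<lambda>n. z i ^ n) \<in> borel_measurable (count_space UNIV)" by simp
      then show "(\<lambda>s. z i ^ s i) \<in> borel_measurable count_sequences"
        by (rule measurable_compose[OF measurable_component_singleton, rotated]) simp
    qed
    show "\<bar>\<Prod>i<k. z i ^ s i\<bar> \<le> 1" for s
      unfolding abs_prod using z by (intro prod_le_1) (auto simp: power_le_one less_imp_le)
  qed
  have jump_int_H: "jump_int G s = (\<integral>x. G (\<lambda>i. s i + indicator (B i) x) \<partial>\<sigma>)" for G s
    unfolding jump_int_def by (simp add: \<tau>_def)
  have jump: "jump_int (\<lambda>s. c * H s) = (\<lambda>s. (c * a) * H s)" for c
    by (simp add: jump_int_H H_def a_def power_add prod.distrib fun_eq_iff mult_ac)
  have iter: "(jump_int ^^ n) H = (\<lambda>s. a ^ n * H s)" for n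
  proof (induction n)
    case (Suc n)
    then show ?case by (simp only: funpow.simps o_apply jump) (simp add: mult.commute)
  qed simp
  have "(\<lambda>n. a ^ n /\<^sub>R fact n) sums exp a" by (rule exp_converges)
  then have "(\<lambda>n. exp (- mass) * (a ^ n /\<^sub>R fact n)) sums (exp (- mass) * exp a)"
    by (rule sums_mult)
  then have "(\<lambda>n. exp (- mass) / fact n * (jump_int ^^ n) H (\<lambda>_. 0)) sums (exp (- mass) * exp a)"
    by (simp add: iter H_def field_simps)
  then have "jump_law (\<lambda>_. 0) H = exp (- mass) * exp a"
    unfolding jump_law_def by (rule sums_unique[symmetric])
  then show "jump_law (\<lambda>_. 0) (\<lambda>s. \<Prod>i<k. z i ^ s i)
      = exp ((\<integral>x. (\<Prod>i<k. z i ^ indicator (B i) x) \<partial>\<sigma>) - measure \<sigma> UNIV)"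
    by (simp add: H_def[abs_def] a_def mass_def exp_diff exp_minus field_simps)
qed

lemma measurable_nums:
  assumes "\<And>i::nat. B i \<in> sets borel"
  shows "(\<lambda>\<omega> i. num (B i) \<omega>) \<in> \<pi> \<rightarrow>\<^sub>M count_sequences"
  by (rule measurable_PiM_single') (auto intro: measurable_num assms)

text \<open>Growth from the empty configuration reproduces the Poisson law of the counts because the
  two generating functions coincide.\<close>

lemma distr_nums:
  assumes B: "\<And>i::nat. B i \<in> sets borel"
  shows "distr \<pi> count_sequences (\<lambda>\<omega> i. num (B i) \<omega>)
    = commuting_jumps.jump_law_measure \<sigma> count_sequences (\<lambda>x s i. s i + indicator (B i) x) (\<lambda>_. 0)"
proof -
  interpret J: commuting_jumps \<sigma> count_sequences "\<lambda>x s i. s i + indicator (B i) x"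
    using B by (rule commuting_jumps_counts)
  interpret N: prob_space "distr \<pi> count_sequences (\<lambda>\<omega> i. num (B i) \<omega>)"
    by (rule \<pi>.prob_space_distr[OF measurable_nums[OF B]])
  show ?thesis
  proof (rule measure_eqI_generating_function)
    fix z :: "nat \<Rightarrow> real" and k
    assume z: "\<And>i. 0 < z i" "\<And>i. z i < 1"
    note bdd = jump_law_generating_function(1)[OF B z]
    have "(\<integral>s. (\<Prod>i<k. z i ^ s i) \<partial>distr \<pi> count_sequences (\<lambda>\<omega> i. num (B i) \<omega>))
        = (\<integral>\<omega>. (\<Prod>i<k. z i ^ num (B i) \<omega>) \<partial>\<pi>)"
      by (rule integral_distr[OF measurable_nums[OF B] J.bdd_measD[OF bdd]])
    also have "\<dots> = exp ((\<integral>x. (\<Prod>i<k. z i ^ indicator (B i) x) \<partial>\<sigma>) - measure \<sigma> UNIV)"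
      by (rule generating_function_nums[OF B z])
    also have "\<dots> = J.jump_law (\<lambda>_. 0) (\<lambda>s. \<Prod>i<k. z i ^ s i)"
      by (rule jump_law_generating_function(2)[OF B z, symmetric])
    also have "\<dots> = (\<integral>s. (\<Prod>i<k. z i ^ s i) \<partial>J.jump_law_measure (\<lambda>_. 0))"
      using z by (intro J.integral_jump_law_measure[symmetric] bdd prod_nonneg) (auto simp: less_imp_le)
    finally show "(\<integral>s. (\<Prod>i<k. z i ^ s i) \<partial>distr \<pi> count_sequences (\<lambda>\<omega> i. num (B i) \<omega>))
        = (\<integral>s. (\<Prod>i<k. z i ^ s i) \<partial>J.jump_law_measure (\<lambda>_. 0))" .
  qed (simp_all add: N.finite_measure_axioms J.finite_jump_law_measure)
qed

end

section \<open>Transfer from counts to configurations\<close>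

theorem proposition2p5:
  fixes \<sigma> :: "'a::metric_space measure"
    and \<pi> :: "'a set measure"
    and F :: "'a set \<Rightarrow> real"
  assumes "sets \<sigma> = sets borel"
    and "finite_measure \<sigma>"
    and "\<forall>x. emeasure \<sigma> {x} = 0"
    and "poisson_measure \<sigma> \<pi>"
    and "F \<in> borel_measurable configuration_space"
    and "\<forall>\<omega> \<in> configurations. 0 \<le> F \<omega> \<and> F \<omega> \<le> 1"
  shows "Gauss_isoperimetric (\<integral>\<omega>. F \<omega> \<partial>\<pi>) \<le>
    (\<integral>\<omega>. sqrt ((Gauss_isoperimetric (F \<omega>))\<^sup>2 +
            2 * (\<integral>x. \<bar>fd_gradient x F \<omega>\<bar>\<^sup>2 \<partial>\<sigma>)) \<partial>\<pi>)"
proof -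
  interpret poisson_process \<sigma> \<pi>
    using assms by (simp add: poisson_process_def poisson_process_axioms_def)
  obtain B g where B: "\<And>i::nat. B i \<in> sets borel" and g [measurable]: "g \<in> borel_measurable enn_sequences"
    and g01: "\<And>s. 0 \<le> g s" "\<And>s. g s \<le> 1"
    and Fg: "\<And>\<omega>. \<omega> \<in> configurations \<Longrightarrow> F \<omega> = g (\<lambda>i. emeasure (point_measure_of \<omega>) (B i))"
    using configuration_space_fun_countable_counts[OF assms(5,6)] by metis
  interpret J: commuting_jumps \<sigma> count_sequences "\<lambda>x s i. s i + indicator (B i) x"
    using B by (rule commuting_jumps_counts)
  define N where "N = distr \<pi> count_sequences (\<lambda>\<omega> i. num (B i) \<omega>)"
  define G where "G s = g (\<lambda>i. of_nat (s i))" for s :: "nat \<Rightarrow> nat"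
  define c where "c \<omega> i = emeasure (point_measure_of \<omega>) (B i)" for \<omega> and i :: nat
  \<comment> \<open>The gradient term as a function of extended counts. Composed with
    \<open>c\<close> it is measurable on all of \<open>\<pi>\<close>, infinite configurations
    included, so it can mediate between the natural counts and the true gradient.\<close>
  define R where "R s = (\<integral>x. (g s - g (\<lambda>i. s i + indicator (B i) x))\<^sup>2 \<partial>\<sigma>)" for s
  have G_meas: "G \<in> borel_measurable count_sequences"
    unfolding G_def
  proof (rule measurable_compose[OF _ g], rule measurable_PiM_single')
    fix i :: nat
    have "of_nat \<in> count_space UNIV \<rightarrow>\<^sub>M (borel :: ennreal measure)" by simp
    then show "(\<lambda>s. of_nat (s i)) \<in> count_sequences \<rightarrow>\<^sub>M (borel :: ennreal measure)"
      by (rule measurable_compose[OF measurable_component_singleton, rotated]) simp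
  qed simp
  have bddG: "J.bdd_meas G"
    using g01 by (intro J.bdd_measI[OF G_meas, of 1]) (auto simp: G_def)
  have c_meas [measurable]: "c \<in> \<pi> \<rightarrow>\<^sub>M enn_sequences"
    unfolding c_def[abs_def] by (rule measurable_PiM_single') (auto intro: measurable_count_\<pi> B)
  have shift [measurable]: "(\<lambda>p i. fst p i + indicator (B i) (snd p)) \<in> enn_sequences \<Otimes>\<^sub>M \<sigma> \<rightarrow>\<^sub>M enn_sequences"
  proof (rule measurable_PiM_single')
    fix i :: nat
    have [measurable]: "B i \<in> sets \<sigma>" using B sets_\<sigma> by simp
    have [measurable]: "(\<lambda>p. fst p i) \<in> enn_sequences \<Otimes>\<^sub>M \<sigma> \<rightarrow>\<^sub>M borel"
      by (rule measurable_compose[OF measurable_fst measurable_component_singleton]) simp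
    show "(\<lambda>p. fst p i + indicator (B i) (snd p)) \<in> enn_sequences \<Otimes>\<^sub>M \<sigma> \<rightarrow>\<^sub>M borel" by measurable
  qed simp
  have gshift [measurable]: "(\<lambda>p. g (\<lambda>i. fst p i + indicator (B i) (snd p))) \<in> borel_measurable (enn_sequences \<Otimes>\<^sub>M \<sigma>)"
    by (rule measurable_compose[OF shift g])
  have R_meas [measurable]: "R \<in> borel_measurable enn_sequences"
    unfolding R_def[abs_def]
  proof (rule borel_measurable_lebesgue_integral)
    show "(\<lambda>(s, x). (g s - g (\<lambda>i. s i + indicator (B i) x))\<^sup>2) \<in> borel_measurable (enn_sequences \<Otimes>\<^sub>M \<sigma>)"
      unfolding split_beta' by measurable
  qed
  \<comment> \<open>Off \<open>\<omega>\<close> the gradient adds a point and the counts rise by the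
    indicators. On \<open>\<omega>\<close> it removes one instead, but \<open>\<omega>\<close> is
    countable and \<open>\<sigma>\<close> has no atoms.\<close>
  have grad: "(\<integral>x. \<bar>fd_gradient x F \<omega>\<bar>\<^sup>2 \<partial>\<sigma>) = R (c \<omega>)" if \<omega>: "\<omega> \<in> configurations" for \<omega>
  proof -
    have countable: "countable \<omega>" using \<omega> by (simp add: configurations_def)
    have eq: "(g (c \<omega>) - g (\<lambda>i. c \<omega> i + indicator (B i) x))\<^sup>2 = \<bar>fd_gradient x F \<omega>\<bar>\<^sup>2"
      if x: "x \<notin> \<omega>" for x
      using x \<omega> Fg[OF \<omega>] Fg[OF insert_in_configurations[OF \<omega>], of x] B
      by (simp add: fd_gradient_def c_def[abs_def] emeasure_point_measure_insert)
    have "(\<lambda>x. (c \<omega>, x)) \<in> \<sigma> \<rightarrow>\<^sub>M enn_sequences \<Otimes>\<^sub>M \<sigma>"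
      by (intro measurable_Pair measurable_const) (auto intro: measurable_ident)
    from measurable_compose[OF this gshift]
    have "(\<lambda>x. (g (c \<omega>) - g (\<lambda>i. c \<omega> i + indicator (B i) x))\<^sup>2) \<in> borel_measurable \<sigma>"
      by simp
    note meas = this
    \<comment> \<open>The gradient is measurable in x because it differs from a measurable function
      on a countable set only, and singletons are Borel.\<close>
    have meas': "(\<lambda>x. \<bar>fd_gradient x F \<omega>\<bar>\<^sup>2) \<in> borel_measurable \<sigma>"
      by (rule measurable_discrete_difference[OF meas countable])
        (use eq in \<open>auto simp: sets_\<sigma>\<close>)
    have "AE x in \<sigma>. x \<notin> \<omega>"
    proof (rule AE_not_in)
      have "(\<Union>x\<in>\<omega>. {x}) \<in> null_sets \<sigma>"
        using countable assms(3) by (intro null_sets_UN') (auto simp: null_sets_def sets_\<sigma>)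
      then show "\<omega> \<in> null_sets \<sigma>" by simp
    qed
    then show ?thesis
      unfolding R_def by (intro integral_cong_AE meas meas') (auto elim!: eventually_mono simp: eq)
  qed
  \<comment> \<open>For finitely many points the extended counts are natural numbers, and
    \<open>R\<close> becomes the gradient of the chain.\<close>
  have finite: "F \<omega> = G (\<lambda>i. num (B i) \<omega>) \<and> g (c \<omega>) = G (\<lambda>i. num (B i) \<omega>)
      \<and> R (c \<omega>) = J.sq_grad G (\<lambda>i. num (B i) \<omega>)"
    if "\<omega> \<in> configurations" "finite \<omega>" for \<omega>
  proof -
    have c: "c \<omega> = (\<lambda>i. of_nat (num (B i) \<omega>))"
      using that B by (simp add: c_def num_finite emeasure_point_measure_finite fun_eq_iff)
    have "g (\<lambda>i. c \<omega> i + indicator (B i) x) = G (\<lambda>i. num (B i) \<omega> + indicator (B i) x)" for x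
    proof -
      have "c \<omega> i + indicator (B i) x = of_nat (num (B i) \<omega> + indicator (B i) x)" for i
        unfolding c by (simp add: indicator_def)
      then show ?thesis by (simp add: G_def)
    qed
    moreover have "g (c \<omega>) = G (\<lambda>i. num (B i) \<omega>)" by (simp add: c G_def)
    ultimately show ?thesis
      using Fg[OF that(1)] by (simp add: R_def J.sq_grad_def c_def[symmetric] power2_commute)
  qed
  have [measurable]: "F \<in> borel_measurable \<pi>"
    using assms(5) by (simp cong: measurable_cong_sets add: sets_\<pi>)
  note nums = measurable_nums[OF B]
  define Q where "Q s = sqrt ((Gauss_isoperimetric (G s))\<^sup>2 + 2 * J.sq_grad G s)" for s
  have Q: "Q \<in> borel_measurable count_sequences"
    unfolding Q_def[abs_def]
    by (rule J.bdd_measD, intro J.bdd_meas_sqrt J.bdd_meas_Gauss_isoperimetric bddG) simp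
  have "prob_space N"
    unfolding N_def by (rule \<pi>.prob_space_distr[OF nums])
  moreover have "sets N = sets count_sequences" by (simp add: N_def)
  moreover have "(\<integral>s. H s \<partial>N) = J.jump_law (\<lambda>_. 0) H" if "J.bdd_meas H" "\<And>s. 0 \<le> H s" for H
    unfolding N_def distr_nums[OF B] using that by (rule J.integral_jump_law_measure)
  ultimately have "Gauss_isoperimetric (\<integral>s. G s \<partial>N) \<le> (\<integral>s. Q s \<partial>N)"
    unfolding Q_def by (rule J.Bobkov_jump_law) (assumption, assumption, rule G_meas, simp_all add: G_def g01)
  also have "(\<integral>s. G s \<partial>N) = (\<integral>\<omega>. F \<omega> \<partial>\<pi>)"
    unfolding N_def integral_distr[OF nums G_meas]
    by (intro integral_cong_AE measurable_compose[OF nums G_meas])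
      (use AE_finite AE_space in \<open>auto simp: space_\<pi> finite elim!: eventually_elim2\<close>)
  also have "(\<integral>s. Q s \<partial>N) = (\<integral>\<omega>. sqrt ((Gauss_isoperimetric (g (c \<omega>)))\<^sup>2 + 2 * R (c \<omega>)) \<partial>\<pi>)"
    unfolding N_def integral_distr[OF nums Q]
  proof (rule integral_cong_AE)
    show "AE \<omega> in \<pi>. Q (\<lambda>i. num (B i) \<omega>) = sqrt ((Gauss_isoperimetric (g (c \<omega>)))\<^sup>2 + 2 * R (c \<omega>))"
      using AE_finite AE_space by eventually_elim (simp add: finite space_\<pi> Q_def)
  qed (auto intro: measurable_compose[OF nums Q])
  also have "\<dots> = (\<integral>\<omega>. sqrt ((Gauss_isoperimetric (F \<omega>))\<^sup>2 +
            2 * (\<integral>x. \<bar>fd_gradient x F \<omega>\<bar>\<^sup>2 \<partial>\<sigma>)) \<partial>\<pi>)"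
  proof (rule Bochner_Integration.integral_cong[OF refl])
    fix \<omega> assume "\<omega> \<in> space \<pi>"
    then have \<omega>: "\<omega> \<in> configurations" by (simp add: space_\<pi>)
    have "g (c \<omega>) = F \<omega>" by (simp add: Fg[OF \<omega>] c_def[abs_def])
    then show "sqrt ((Gauss_isoperimetric (g (c \<omega>)))\<^sup>2 + 2 * R (c \<omega>))
        = sqrt ((Gauss_isoperimetric (F \<omega>))\<^sup>2 + 2 * (\<integral>x. \<bar>fd_gradient x F \<omega>\<bar>\<^sup>2 \<partial>\<sigma>))"
      by (simp only: grad[OF \<omega>])
  qed
  finally show ?thesis .
qed

end
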